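(* Let $d$ and $n$ be positive integers with $d>n^{1/2}$. There exists a Krull monoid that is not half-factorial, is $d$-congruence half-factorial, and has finite cyclic class group of order $n$, if and only if $d\in\bigcup_{m\mid n}J(m)$.
   Context: For a positive integer $m$, $J(m)$ is the set of all positive integers dividing some positive integer of the form $\frac{m-c_1-c_2}{c_1c_2}$ with $c_1,c_2\in[1,m]$. A monoid is a commutative cancellative semigroup with identity; for $a\in H$, $\mathsf L(a)$ is the set of all $\ell\ge0$ such that $a$ is a product of $\ell$ irreducible elements of $H$. $H$ is half-factorial if $|\mathsf L(a)|=1$ for all $a$; it is $d$-congruence half-factorial if $\ell\equiv\ell'\pmod d$ for all $a\in H$ and $\ell,\ell'\in\mathsf L(a)$. $H$ is a Krull monoid if there is a homomorphism $\varphi:H\to\mathcal F(P)$ into a free abelian monoid with $a\mid b$ iff $\varphi(a)\mid\varphi(b)$; its class group is $\mathsf q(\mathcal F(P))/\mathsf q(\varphi(H))$ for a divisor theory $\varphi$ (such a $\varphi$ where every $p\in P$ is the gcd of finitely many elements of $\varphi(H)$). *)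

theory Defs
  imports
    Complex_Main
    "HOL-Algebra.Divisibility"
    "HOL-Algebra.Elementary_Groups"
    "HOL-Algebra.Free_Abelian_Groups"
    "HOL-Library.Infinite_Typeclass"
    "HOL-Number_Theory.Cong"
begin

text \<open>
  A monoid in the sense of factorization theory is a \<^locale>\<open>comm_monoid_cancel\<close>.
  The set of lengths uses \<^const>\<open>wfactors\<close>, i.e. factorizations up to a unit: for a
  non-unit the unit can be absorbed into a factor, so this is the literal notion, and for
  every unit (not only for the identity) it gives the usual convention that the set of
  lengths is \<open>{0}\<close>.
\<close>

definition lengths :: "('a, 'm) monoid_scheme \<Rightarrow> 'a \<Rightarrow> nat set" where
  "lengths H a = {length us | us. set us \<subseteq> carrier H \<and> wfactors H us a}"

definition half_factorial :: "('a, 'm) monoid_scheme \<Rightarrow> bool" where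
  "half_factorial H \<longleftrightarrow> (\<forall>a\<in>carrier H. card (lengths H a) = 1)"

definition congruence_half_factorial :: "nat \<Rightarrow> ('a, 'm) monoid_scheme \<Rightarrow> bool" where
  "congruence_half_factorial d H \<longleftrightarrow>
     (\<forall>a\<in>carrier H. \<forall>l\<in>lengths H a. \<forall>l'\<in>lengths H a. [l = l'] (mod d))"

text \<open>
  The free abelian monoid with basis \<open>P\<close>, realized as the set of elements with
  nonnegative coefficients of the free abelian group on \<open>P\<close>, which is then its quotient group.
\<close>

definition free_Abelian_monoid :: "'p set \<Rightarrow> ('p \<Rightarrow>\<^sub>0 int) monoid" where
  "free_Abelian_monoid P = (free_Abelian_group P)
     \<lparr>carrier := {c \<in> carrier (free_Abelian_group P). \<forall>p. 0 \<le> Poly_Mapping.lookup c p}\<rparr>"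

definition divisor_hom ::
  "('a, 'm) monoid_scheme \<Rightarrow> 'p set \<Rightarrow> ('a \<Rightarrow> 'p \<Rightarrow>\<^sub>0 int) \<Rightarrow> bool" where
  "divisor_hom H P \<phi> \<longleftrightarrow>
     \<phi> \<in> hom H (free_Abelian_monoid P) \<and> \<phi> \<one>\<^bsub>H\<^esub> = \<one>\<^bsub>free_Abelian_monoid P\<^esub> \<and>
     (\<forall>a\<in>carrier H. \<forall>b\<in>carrier H.
        a divides\<^bsub>H\<^esub> b \<longleftrightarrow> \<phi> a divides\<^bsub>free_Abelian_monoid P\<^esub> \<phi> b)"

text \<open>
  The type of the set \<open>P\<close> of primes cannot be quantified inside a formula, so it is an
  explicit type parameter.
\<close>

definition krull_monoid :: "'p itself \<Rightarrow> ('a, 'm) monoid_scheme \<Rightarrow> bool" where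
  "krull_monoid TYPE('p) H \<longleftrightarrow>
     comm_monoid_cancel H \<and> (\<exists>(P :: 'p set) \<phi>. divisor_hom H P \<phi>)"

definition is_gcd_of_set :: "('a, 'm) monoid_scheme \<Rightarrow> 'a \<Rightarrow> 'a set \<Rightarrow> bool" where
  "is_gcd_of_set F x A \<longleftrightarrow> (\<forall>a\<in>A. x divides\<^bsub>F\<^esub> a) \<and>
     (\<forall>y\<in>carrier F. (\<forall>a\<in>A. y divides\<^bsub>F\<^esub> a) \<longrightarrow> y divides\<^bsub>F\<^esub> x)"

definition divisor_theory ::
  "('a, 'm) monoid_scheme \<Rightarrow> 'p set \<Rightarrow> ('a \<Rightarrow> 'p \<Rightarrow>\<^sub>0 int) \<Rightarrow> bool" where
  "divisor_theory H P \<phi> \<longleftrightarrow> divisor_hom H P \<phi> \<and>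
     (\<forall>p\<in>P. \<exists>A \<subseteq> carrier H. finite A \<and> A \<noteq> {} \<and>
        is_gcd_of_set (free_Abelian_monoid P) (Poly_Mapping.single p 1) (\<phi> ` A))"

definition class_group ::
  "('a, 'm) monoid_scheme \<Rightarrow> 'p set \<Rightarrow> ('a \<Rightarrow> 'p \<Rightarrow>\<^sub>0 int) \<Rightarrow> ('p \<Rightarrow>\<^sub>0 int) set monoid" where
  "class_group H P \<phi> = free_Abelian_group P Mod {\<phi> a - \<phi> b | a b. a \<in> carrier H \<and> b \<in> carrier H}"

definition J :: "nat \<Rightarrow> nat set" where
  "J m = {k. k > 0 \<and> (\<exists>c\<^sub>1\<in>{1..m}. \<exists>c\<^sub>2\<in>{1..m}. \<exists>q::nat. q > 0 \<and>
     (real m - real c\<^sub>1 - real c\<^sub>2) / (real c\<^sub>1 * real c\<^sub>2) = real q \<and> k dvd q)}"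

end

theory Submission
  imports Defs "HOL-Algebra.Multiplicative_Group"
begin

text \<open>
  Let \<open>cl p\<close> denote the class of the prime \<open>p\<close> in the cyclic group of order \<open>n\<close>. Through a divisor
  theory, factorizations in the monoid become factorizations of nonnegative vectors on the set of
  primes whose sum of classes vanishes into minimal such vectors.

  For two primes the minimal vectors are the vertices of a Hirzebruch--Jung continued fraction, and
  consecutive ones satisfy \<open>U + R = t V\<close>, so congruence half-factoriality forces \<open>t \<equiv> 2\<close> modulo \<open>d\<close>.
  If exactly one of the numbers \<open>t\<close> differs from 2, say \<open>t = q + 2\<close>, the determinant is
  \<open>c\<^sub>1 + c\<^sub>2 + q c\<^sub>1 c\<^sub>2\<close>, which divides \<open>n\<close> and witnesses membership in the union of the sets \<open>J m\<close>; if two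
  of them do, the determinant exceeds \<open>d\<^sup>2 > n\<close>. If all of them equal 2 for all pairs of primes, then all
  minimal vectors supported on two primes have cross number 1. Since the group is cyclic, vectors
  supported on two primes generate all zero-sum vectors, so every minimal vector has an integral
  cross number that is congruent to 1 modulo \<open>d\<close>. The orders of the classes lie in fewer than \<open>d\<close>
  divisibility chains, each contributing less than 1 to a cross number different from 1. Hence all
  cross numbers are 1, which makes the monoid half-factorial.

  Conversely, for \<open>n = m r\<close> and \<open>m = c\<^sub>1 + c\<^sub>2 + q c\<^sub>1 c\<^sub>2\<close>, three primes of the classes \<open>(1 + q c\<^sub>2) r\<close>, 1, 1
  realize the continued fraction with the single exceptional entry \<open>q + 2\<close>.
\<close>

section \<open>Zero-sum vectors on two classes\<close>

definition pair_block :: "int \<Rightarrow> int \<Rightarrow> int \<times> int \<Rightarrow> bool" where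
  "pair_block N e U \<longleftrightarrow> 0 \<le> fst U \<and> 0 \<le> snd U \<and> N dvd e * fst U + snd U"

definition pair_atom :: "int \<Rightarrow> int \<Rightarrow> int \<times> int \<Rightarrow> bool" where
  "pair_atom N e U \<longleftrightarrow> pair_block N e U \<and> U \<noteq> (0, 0) \<and>
     (\<forall>V. pair_block N e V \<longrightarrow> V \<noteq> (0, 0) \<longrightarrow> fst V \<le> fst U \<longrightarrow> snd V \<le> snd U \<longrightarrow> V = U)"

text \<open>Minimality read as a running minimum: scanning by the first coordinate, the second one
  drops strictly below everything met before. This asymmetric form suits the construction of one
  vertex after another.\<close>

definition record_low :: "int \<Rightarrow> int \<Rightarrow> int \<times> int \<Rightarrow> bool" where
  "record_low N e U \<longleftrightarrow> pair_block N e U \<and> U \<noteq> (0, 0) \<and>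
     (\<forall>V. pair_block N e V \<longrightarrow> V \<noteq> (0, 0) \<longrightarrow> V \<noteq> U \<longrightarrow> fst V \<le> fst U \<longrightarrow> snd U < snd V)"

lemma record_low_imp_pair_atom: "record_low N e U \<Longrightarrow> pair_atom N e U"
  unfolding record_low_def pair_atom_def by force

text \<open>The determinant \<open>N\<close> is the index of the lattice
  \<open>N dvd e * x + y\<close>, so two adjacent records form a lattice basis.\<close>

definition adjacent_records :: "int \<Rightarrow> int \<Rightarrow> int \<times> int \<Rightarrow> int \<times> int \<Rightarrow> bool" where
  "adjacent_records N e U V \<longleftrightarrow> record_low N e U \<and> record_low N e V \<and>
     fst V * snd U - fst U * snd V = N \<and> snd V < snd U"

lemma adjacent_records_start:
  assumes "0 < e" "e < N"
  shows "adjacent_records N e (0, N) (1, N - e)"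
proof -
  have "record_low N e (0, N)"
    unfolding record_low_def pair_block_def
  proof (intro conjI allI impI)
    fix V :: "int \<times> int"
    assume V: "0 \<le> fst V \<and> 0 \<le> snd V \<and> N dvd e * fst V + snd V" "V \<noteq> (0, 0)" "V \<noteq> (0, N)"
      "fst V \<le> fst (0, N)"
    then have "fst V = 0" "N dvd snd V" by auto
    with V have "snd V > 0" "snd V \<noteq> N" by (auto simp: prod_eq_iff)
    with \<open>N dvd snd V\<close> have "N < snd V"
      using zdvd_imp_le[of N "snd V"] by linarith
    then show "snd (0, N) < snd V" by simp
  qed (use assms in \<open>auto simp: prod_eq_iff\<close>)
  moreover have "record_low N e (1, N - e)"
    unfolding record_low_def pair_block_def
  proof (intro conjI allI impI)
    fix V :: "int \<times> int"
    assume V: "0 \<le> fst V \<and> 0 \<le> snd V \<and> N dvd e * fst V + snd V" "V \<noteq> (0, 0)" "V \<noteq> (1, N - e)"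
      "fst V \<le> fst (1, N - e)"
    then consider "fst V = 0" | "fst V = 1" by force
    then show "snd (1, N - e) < snd V"
    proof cases
      case 1
      with V have "snd V > 0" "N dvd snd V" by (auto simp: prod_eq_iff)
      then have "N \<le> snd V" by (simp add: zdvd_imp_le)
      with assms show ?thesis by simp
    next
      case 2
      with V have "N dvd e + snd V" "snd V \<noteq> N - e" by (auto simp: prod_eq_iff)
      moreover have "0 < e + snd V" using V assms by linarith
      ultimately have "N \<le> e + snd V" by (simp add: zdvd_imp_le)
      with \<open>snd V \<noteq> N - e\<close> show ?thesis by simp
    qed
  qed (use assms in \<open>auto simp: prod_eq_iff\<close>)
  ultimately show ?thesis using assms by (simp add: adjacent_records_def)
qed

definition next_record :: "int \<Rightarrow> int \<times> int \<Rightarrow> int \<times> int \<Rightarrow> int \<times> int" where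
  "next_record t U V = (t * fst V - fst U, t * snd V - snd U)"

text \<open>Here \<open>U\<close>, \<open>V\<close>, \<open>R\<close> are consecutive vertices of a Hirzebruch--Jung continued fraction.
  The determinant \<open>D\<close> against \<open>V\<close> takes values in multiples of \<open>N\<close> and equals \<open>N\<close> at \<open>R\<close>, so of
  any decomposition of \<open>R\<close> one summand has \<open>D \<le> 0\<close> and thus lies above the ray through \<open>V\<close>,
  where the record property of \<open>V\<close> applies.\<close>
lemma adjacent_records_step:
  assumes adj: "adjacent_records N e U V" and N: "N > 0"
    and t: "0 \<le> t * snd V - snd U" "t * snd V - snd U < snd V"
  shows "adjacent_records N e V (next_record t U V)"
proof -
  obtain x y x' y' where UV: "U = (x, y)" "V = (x', y')" by (metis surj_pair)
  define X Y where "X = t * x' - x" and "Y = t * y' - y"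
  have R: "next_record t U V = (X, Y)" by (simp add: UV next_record_def X_def Y_def)
  from adj have U: "0 \<le> x" "0 \<le> y" "N dvd e * x + y"
    and V: "0 \<le> x'" "0 \<le> y'" "N dvd e * x' + y'" and V_rec: "record_low N e V"
    and det: "x' * y - x * y' = N" and yy: "y' < y"
    by (auto simp: adjacent_records_def record_low_def pair_block_def UV)
  have Y: "0 \<le> Y" "Y < y'" using t by (auto simp: UV Y_def)
  have t2: "t \<ge> 2"
  proof (rule ccontr)
    assume "\<not> t \<ge> 2"
    then have "t * y' \<le> 1 * y'" using V by (intro mult_right_mono) auto
    with Y yy show False by (simp add: Y_def)
  qed
  have x': "x' > 0"
  proof (rule ccontr)
    assume "\<not> x' > 0"
    then have "x' = 0" using V by simp
    then have "- (x * y') = N" using det by simp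
    with U V N show False by (smt (verit) mult_nonneg_nonneg)
  qed
  have xx: "x < x'"
  proof (rule ccontr)
    assume "\<not> x < x'"
    then have "pair_block N e V" "fst V \<le> fst U" "V \<noteq> U" "V \<noteq> (0, 0)"
      using V yy x' by (auto simp: UV pair_block_def)
    then have "snd U < snd V" using adj unfolding adjacent_records_def record_low_def by blast
    with yy show False by (simp add: UV)
  qed
  have "2 * x' \<le> t * x'" using t2 x' by (intro mult_right_mono) auto
  then have X: "X > x'" using xx by (simp add: X_def)
  have detR: "X * y' - x' * Y = N" using det by (simp add: X_def Y_def algebra_simps)
  have NR: "N dvd e * X + Y"
  proof -
    have "e * X + Y = t * (e * x' + y') - (e * x + y)" by (simp add: X_def Y_def algebra_simps)
    then show ?thesis using U(3) V(3) by simp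
  qed
  have above: "W = (0, 0)" if W: "pair_block N e W" "fst W * y' - snd W * x' \<le> 0" "snd W < y'" for W
  proof (rule ccontr)
    assume "W \<noteq> (0, 0)"
    have "snd W * x' < y' * x'" using W x' by simp
    then have "fst W * y' < x' * y'" using W by (simp add: mult.commute)
    then have "fst W < x'" using V by (smt (verit) mult_right_mono)
    then show False using V_rec W \<open>W \<noteq> (0, 0)\<close> unfolding record_low_def UV by fastforce
  qed
  have "snd (X, Y) < snd W" if W: "pair_block N e W" "W \<noteq> (0, 0)" "W \<noteq> (X, Y)" "fst W \<le> fst (X, Y)" for W
  proof (rule ccontr)
    assume "\<not> snd (X, Y) < snd W"
    then have WY: "snd W \<le> Y" by simp
    define D where "D = fst W * y' - snd W * x'"
    define W' where "W' = (X - fst W, Y - snd W)"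
    have W': "pair_block N e W'"
      using W WY NR unfolding pair_block_def W'_def
      by (auto simp: algebra_simps)
    have "W' \<noteq> (0, 0)" using W by (auto simp: W'_def prod_eq_iff)
    have "N dvd D"
    proof -
      have "D = fst W * (e * x' + y') - x' * (e * fst W + snd W)"
        by (simp add: D_def algebra_simps)
      then show ?thesis using W V by (simp add: pair_block_def)
    qed
    moreover have "\<not> D \<le> 0" using above[OF W(1)] W(2) WY Y by (auto simp: D_def)
    ultimately have "D \<ge> N" by (simp add: zdvd_imp_le)
    then have "fst W' * y' - snd W' * x' \<le> 0" using detR by (simp add: D_def W'_def algebra_simps)
    moreover have "snd W' < y'" using W Y by (simp add: W'_def pair_block_def)
    ultimately show False using above[OF W'] \<open>W' \<noteq> (0, 0)\<close> by simp
  qed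
  then have "record_low N e (X, Y)"
    using X x' Y NR unfolding record_low_def by (auto simp: pair_block_def prod_eq_iff)
  moreover have "fst (X, Y) * snd V - fst V * snd (X, Y) = N" "snd (X, Y) < snd V"
    using detR Y by (auto simp: UV)
  ultimately show ?thesis using V_rec unfolding adjacent_records_def R by blast
qed

text \<open>With \<open>R = next_record t U V\<close>, the vector \<open>t V = U + R\<close> is a
  sum of \<open>t\<close> atoms and also of two atoms. Stating this for arbitrary atoms lets it be
  read off from factorization lengths without locating consecutive records.\<close>

definition turn_condition :: "int \<Rightarrow> int \<Rightarrow> int \<Rightarrow> bool" where
  "turn_condition d N e \<longleftrightarrow> (\<forall>U V t. pair_atom N e U \<longrightarrow> pair_atom N e V \<longrightarrow>
     pair_atom N e (next_record t U V) \<longrightarrow> d dvd t - 2)"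

text \<open>As long as one more gap fits below the last second coordinate, the step with
  \<open>t = 2\<close> is admissible, and it reproduces the gap: the second coordinates run through
  an arithmetic progression.\<close>

lemma adjacent_records_straight:
  assumes "adjacent_records N e U V" "N > 0" "i * (snd U - snd V) \<le> snd V"
  shows "\<exists>U' V'. adjacent_records N e U' V' \<and> snd U' = snd U - int i * (snd U - snd V) \<and>
           snd V' = snd V - int i * (snd U - snd V)"
  using assms(3)
proof (induction i)
  case 0
  show ?case using assms(1) by (intro exI[of _ U] exI[of _ V]) simp
next
  case (Suc i)
  have pos: "snd U - snd V > 0" using assms(1) by (simp add: adjacent_records_def)
  then have "i * (snd U - snd V) \<le> snd V" using Suc.prems by (simp add: algebra_simps)
  with Suc.IH obtain U' V' where *: "adjacent_records N e U' V'"
    "snd U' = snd U - int i * (snd U - snd V)" "snd V' = snd V - int i * (snd U - snd V)" by blast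
  have "adjacent_records N e V' (next_record 2 U' V')"
    by (rule adjacent_records_step[OF *(1) assms(2)])
      (use * Suc.prems pos in \<open>auto simp: algebra_simps\<close>)
  moreover have "snd V' = snd U - int (Suc i) * (snd U - snd V)"
    "snd (next_record 2 U' V') = snd V - int (Suc i) * (snd U - snd V)"
    using * by (auto simp: next_record_def algebra_simps)
  ultimately show ?case by blast
qed

text \<open>The second coordinates follow a Euclidean algorithm. The gap \<open>f\<close> is
  repeated until only the remainder \<open>y\<close> is left, then one step with
  \<open>t = q + 2\<close> turns the boundary and leaves the gap \<open>f'\<close>, which is smaller
  than \<open>f\<close>. The data returned allow a second application.\<close>

lemma adjacent_records_bend:
  assumes adj: "adjacent_records N e U V" and N: "N > 0" and cop: "coprime (snd U) (snd V)"
    and gap: "snd U - snd V = f" "f > 1" and turn: "turn_condition d N e"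
  shows "\<exists>c y q f' U' V'. snd U = c * f + y \<and> c > 0 \<and> 0 < y \<and> y < f \<and> f = q * y + f' \<and>
    0 < f' \<and> f' \<le> y \<and> d dvd q \<and> q > 0 \<and>
    adjacent_records N e U' V' \<and> snd U' = y \<and> snd V' = y - f' \<and> coprime y (y - f')"
proof -
  define c y where "c = snd U div f" and "y = snd U mod f"
  have U: "snd U = c * f + y" by (simp add: c_def y_def)
  have V0: "snd V \<ge> 0" using adj by (simp add: adjacent_records_def record_low_def pair_block_def)
  have copf: "coprime f (snd U)"
    using cop gap(1) by (metis coprime_commute coprime_diff_one_left gcd_diff2 coprime_iff_gcd_eq_1)
  have y: "0 \<le> y" "y < f" using gap by (auto simp: y_def)
  \<comment> \<open>A zero remainder would make \<open>f > 1\<close> a common divisor of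
    \<open>f\<close> and \<open>snd U\<close>.\<close>
  have "y \<noteq> 0"
  proof
    assume "y = 0"
    then have "f dvd snd U" by (auto simp: y_def)
    then have "is_unit f" using copf by (metis coprime_common_divisor dvd_refl)
    then show False using gap by simp
  qed
  with y have y0: "y > 0" by simp
  have c: "c > 0" unfolding c_def using gap V0 by (simp add: pos_imp_zdiv_pos_iff)
  obtain i where i: "c = int i + 1"
    using c by (metis add.commute zle_iff_zadd zless_imp_add1_zle add_0)
  have Vy: "snd V - int i * f = y" using U gap i by (simp add: algebra_simps)
  have "int i * (snd U - snd V) \<le> snd V" using Vy y0 gap by (simp add: algebra_simps)
  from adjacent_records_straight[OF adj N this] obtain U1 V1 where
    1: "adjacent_records N e U1 V1" "snd U1 = y + f" "snd V1 = y"
    using gap Vy by auto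
  \<comment> \<open>Dividing \<open>f - 1\<close> instead of \<open>f\<close> puts \<open>f'\<close>
    between 1 and \<open>y\<close>, so the next second coordinate
    \<open>(q + 2) * y - (y + f) = y - f'\<close> is nonnegative and below \<open>y\<close>, as the
    step requires.\<close>
  define q where "q = (f - 1) div y"
  define f' where "f' = f - q * y"
  have f'_eq: "f' = (f - 1) mod y + 1" 
    unfolding f'_def q_def by (simp add: minus_div_mult_eq_mod[symmetric])
  have f': "0 < f'" "f' \<le> y"
    using pos_mod_bound[OF y0, of "f - 1"] pos_mod_sign[OF y0, of "f - 1"] unfolding f'_eq by linarith+
  have q: "q > 0" unfolding q_def using y y0 by (simp add: pos_imp_zdiv_pos_iff)
  have 2: "adjacent_records N e V1 (next_record (q + 2) U1 V1)"
    by (rule adjacent_records_step[OF 1(1) N]) (use 1 f' in \<open>auto simp: f'_def algebra_simps\<close>)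
  have "d dvd (q + 2) - 2"
    using turn 1 2 record_low_imp_pair_atom unfolding turn_condition_def adjacent_records_def by blast
  then have "d dvd q" by simp
  have "coprime y (y - f')"
  proof -
    have "coprime f y"
      using copf unfolding y_def by (metis coprime_mod_right_iff gap(2) not_one_less_zero)
    then have "gcd y f = 1" by (simp add: coprime_iff_gcd_eq_1 gcd.commute)
    have "y - f' = (1 + q) * y - f" by (simp add: f'_def algebra_simps)
    moreover have "coprime y ((1 + q) * y - f)"
      by (metis \<open>coprime f y\<close> coprime_commute coprime_iff_gcd_eq_1 gcd_diff1 gcd_add_mult mult.commute
          diff_conv_add_uminus gcd_neg2 uminus_add_conv_diff)
    ultimately show ?thesis by simp
  qed
  moreover have "snd (next_record (q + 2) U1 V1) = y - f'" "f = q * y + f'"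
    using 1 by (auto simp: f'_def next_record_def algebra_simps)
  ultimately show ?thesis
    using U c y0 y f' \<open>d dvd q\<close> q 2 1 by blast
qed

text \<open>The first gap is \<open>e\<close>. If the first bend leaves the gap 1, inserting
  \<open>e = q * y + 1\<close> into \<open>N = c * e + y\<close> gives the formula with
  \<open>c1 = c\<close> and \<open>c2 = y\<close>. Otherwise there is a second bend, whose
  \<open>q2 \<ge> d\<close> forces \<open>y \<ge> f' \<ge> d\<close>, and then
  \<open>e \<ge> q * y \<ge> d * d > N\<close>.\<close>

lemma pair_block_determinant:
  assumes e: "1 < e" "e < N" "coprime e N" and N: "N < d * d" and d: "d > 0"
    and turn: "turn_condition d N e"
  shows "\<exists>c1 c2 q. c1 > 0 \<and> c2 > 0 \<and> q > 0 \<and> d dvd q \<and> N = c1 + c2 + q * c1 * c2"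
proof -
  have N0: "N > 0" using e by simp
  have start: "adjacent_records N e (0, N) (1, N - e)"
    using e by (intro adjacent_records_start) auto
  have "coprime N (N - e)"
    using e(3) by (metis coprime_commute coprime_iff_gcd_eq_1 gcd_diff1 gcd_diff2)
  then obtain c y q f' U' V' where 1: "N = c * e + y" "c > 0" "0 < y" "y < e" "e = q * y + f'"
    "0 < f'" "f' \<le> y" "d dvd q" "q > 0"
    "adjacent_records N e U' V'" "snd U' = y" "snd V' = y - f'" "coprime y (y - f')"
    using adjacent_records_bend[OF start N0 _ _ e(1) turn] by auto
  have dq: "d \<le> q" using 1 by (simp add: zdvd_imp_le)
  show ?thesis
  proof (cases "f' = 1")
    case True
    then have "N = c + y + q * c * y" using 1 by (simp add: algebra_simps)
    then show ?thesis using 1 by blast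
  next
    case False
    then have "f' > 1" using 1 by simp
    then obtain y2 q2 f2 where 2: "0 < (y2::int)" "f' = q2 * y2 + f2" "0 < f2" "d dvd q2" "q2 > 0"
      using adjacent_records_bend[OF 1(10) N0 _ _ _ turn, of f'] 1 by auto
    have "d \<le> q2" using 2 by (simp add: zdvd_imp_le)
    also have "q2 * 1 \<le> q2 * y2" using 2 by (intro mult_left_mono) auto
    finally have "d \<le> y" using 2 1 by simp
    then have "d * d \<le> q * y" using d dq by (intro mult_mono) auto
    also have "\<dots> \<le> e" using 1 by simp
    finally show ?thesis using N e by simp
  qed
qed

section \<open>Generation of zero-sum vectors by pairs\<close>

text \<open>The ring of weights is left open because class sums and degrees live in the integers and
  cross numbers in the reals.\<close>

definition wsum :: "('p \<Rightarrow> 'b::comm_ring_1) \<Rightarrow> ('p \<Rightarrow>\<^sub>0 int) \<Rightarrow> 'b" where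
  "wsum w c = (\<Sum>p\<in>Poly_Mapping.keys c. of_int (Poly_Mapping.lookup c p) * w p)"

lemma wsum_superset:
  assumes "finite S" "Poly_Mapping.keys c \<subseteq> S"
  shows "wsum w c = (\<Sum>p\<in>S. of_int (Poly_Mapping.lookup c p) * w p)"
  unfolding wsum_def using assms
  by (intro sum.mono_neutral_left) (auto simp: in_keys_iff)

lemma wsum_0 [simp]: "wsum w 0 = 0"
  by (simp add: wsum_def)

lemma wsum_add: "wsum w (b + c) = wsum w b + wsum w c"
proof -
  let ?S = "Poly_Mapping.keys b \<union> Poly_Mapping.keys c"
  have "Poly_Mapping.keys (b + c) \<subseteq> ?S" by (rule Poly_Mapping.keys_add)
  then show ?thesis
    by (simp add: wsum_superset[of ?S] lookup_add algebra_simps sum.distrib)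
qed

lemma wsum_uminus: "wsum w (- c) = - wsum w c"
  by (simp add: wsum_def sum_negf)

lemma wsum_diff: "wsum w (b - c) = wsum w b - wsum w c"
  using wsum_add[of w b "- c"] by (simp add: wsum_uminus)

lemma wsum_single [simp]: "wsum w (Poly_Mapping.single p x) = of_int x * w p"
  by (simp add: wsum_def)

lemma wsum_sum: "wsum w (\<Sum>i\<in>S. f i) = (\<Sum>i\<in>S. wsum w (f i))"
  by (induction S rule: infinite_finite_induct) (auto simp: wsum_add)

text \<open>The distributivity of the ideal lattice of the integers: if \<open>x a\<close> lies in the ideal
  \<open>(b, c, n)\<close>, then \<open>x\<close> is a sum of elements of \<open>(b, n) : a\<close> and \<open>(c, n) : a\<close>.\<close>
lemma split_zero_sum_triple:
  fixes n x y z a b c :: int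
  assumes n: "n \<noteq> 0" and dvd: "n dvd x * a + (y * b + z * c)"
  shows "\<exists>s s' t t'. x = s + s' \<and> n dvd s * a + t * b \<and> n dvd s' * a + t' * c"
proof -
  define B C where "B = gcd b n" and "C = gcd c n"
  define g where "g = gcd B C"
  \<comment> \<open>These generate the ideals \<open>(b, n) : a\<close> and
    \<open>(c, n) : a\<close>, so the task reduces to showing that their gcd divides
    \<open>x\<close>.\<close>
  define \<beta> \<gamma> where "\<beta> = B div gcd a B" and "\<gamma> = C div gcd a C"
  have \<beta>: "\<beta> * gcd a B = B" and \<gamma>: "\<gamma> * gcd a C = C" by (simp_all add: \<beta>_def \<gamma>_def)
  have g0: "g \<noteq> 0" using n by (simp add: g_def B_def)
  have "g dvd n" "g dvd b" "g dvd c" by (auto simp: g_def B_def C_def intro: dvd_trans)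
  then have gxa: "g dvd x * a"
    using dvd by (meson dvd_add_left_iff dvd_add dvd_mult dvd_trans)
  \<comment> \<open>The divisibilities lead from \<open>gcd \<beta> \<gamma> * gcd g a\<close>
    through \<open>g\<close> and \<open>gcd (x * g) (x * a)\<close> to \<open>x * gcd g a\<close>,
    where \<open>gcd g a\<close> cancels.\<close>
  have "gcd \<beta> \<gamma> * gcd g a dvd B" "gcd \<beta> \<gamma> * gcd g a dvd C"
    using mult_dvd_mono[of "gcd \<beta> \<gamma>" \<beta> "gcd g a" "gcd a B"]
      mult_dvd_mono[of "gcd \<beta> \<gamma>" \<gamma> "gcd g a" "gcd a C"]
    by (auto simp: \<beta> \<gamma> g_def intro: dvd_trans)
  then have "gcd \<beta> \<gamma> * gcd g a dvd g" by (simp add: g_def)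
  also have "g dvd gcd (x * g) (x * a)" using gxa by simp
  also have "gcd (x * g) (x * a) dvd x * gcd g a"
    by (simp flip: gcd_mult_distrib_int)
  finally have "gcd \<beta> \<gamma> dvd x" using g0 by simp
  then obtain k where k: "x = gcd \<beta> \<gamma> * k" by blast
  obtain u v where uv: "u * \<beta> + v * \<gamma> = gcd \<beta> \<gamma>" using bezout_int by blast
  obtain b1 n1 where b1: "b1 * b + n1 * n = B" unfolding B_def using bezout_int by blast
  obtain c1 n2 where c1: "c1 * c + n2 * n = C" unfolding C_def using bezout_int by blast
  define a1 a2 where "a1 = a div gcd a B" and "a2 = a div gcd a C"
  have "\<beta> * a = a1 * B" "\<gamma> * a = a2 * C"
    by (simp_all add: \<beta>_def \<gamma>_def a1_def a2_def div_mult_swap dvd_div_mult mult.commute)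
  then have "(k * u * \<beta>) * a + (- (k * u * a1 * b1)) * b = n * (k * u * a1 * n1)"
    "(k * v * \<gamma>) * a + (- (k * v * a2 * c1)) * c = n * (k * v * a2 * n2)"
    by (simp_all add: mult.assoc flip: b1 c1) (simp_all add: algebra_simps)
  moreover have "x = k * u * \<beta> + k * v * \<gamma>" using k uv by (simp add: algebra_simps flip: uv)
  ultimately show ?thesis by (metis dvd_triv_left)
qed

text \<open>Induction on \<open>S\<close>: the whole remaining sum acts as the third term of the
  triple, with coefficient 1, and the multiplier \<open>t'\<close> that comes back is absorbed into
  the coefficients.\<close>

lemma split_zero_sum:
  fixes n x a :: int and c w :: "'i \<Rightarrow> int"
  assumes "finite S" "S \<noteq> {}" "n \<noteq> 0" "n dvd x * a + (\<Sum>i\<in>S. c i * w i)"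
  shows "\<exists>s t. x = (\<Sum>i\<in>S. s i) \<and> (\<forall>i\<in>S. n dvd s i * a + t i * w i)"
  using assms
proof (induction S arbitrary: x c rule: finite_ne_induct)
  case (singleton i)
  then show ?case by (intro exI[of _ "\<lambda>_. x"] exI[of _ c]) auto
next
  case (insert i S)
  have "n dvd x * a + (c i * w i + 1 * (\<Sum>i\<in>S. c i * w i))" using insert by simp
  then obtain s s' t t' where *: "x = s + s'" "n dvd s * a + t * w i"
    "n dvd s' * a + t' * (\<Sum>i\<in>S. c i * w i)"
    using split_zero_sum_triple[OF insert.prems(1)] by blast
  from *(3) have "n dvd s' * a + (\<Sum>i\<in>S. (t' * c i) * w i)"
    by (simp add: sum_distrib_left mult.assoc)
  from insert.IH[OF insert.prems(1) this] obtain f h where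
    fh: "s' = (\<Sum>i\<in>S. f i)" "\<forall>i\<in>S. n dvd f i * a + h i * w i" by blast
  have "(\<Sum>j\<in>S. (f(i := s)) j) = (\<Sum>j\<in>S. f j)" using insert by (intro sum.cong) auto
  then have "x = (\<Sum>j\<in>insert i S. (f(i := s)) j)" using insert(1,3) *(1) fh(1) by simp
  moreover have "\<forall>j\<in>insert i S. n dvd (f(i := s)) j * a + (h(i := t)) j * w j"
    using *(2) fh(2) by simp
  ultimately show ?case by blast
qed

text \<open>Eliminate one prime \<open>r\<close> of the support at a time: its coefficient is
  distributed over zero-sum pairs consisting of \<open>r\<close> and one other prime, and
  subtracting these pairs shrinks the support.\<close>

lemma zero_sum_generated_by_pairs:
  fixes n :: int and cl :: "'p \<Rightarrow> int"
  assumes n: "n \<noteq> 0" and zero: "Q 0" and add: "\<And>b c. Q b \<Longrightarrow> Q c \<Longrightarrow> Q (b + c)"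
    and pair: "\<And>p p' x y. p \<in> P \<Longrightarrow> p' \<in> P \<Longrightarrow> n dvd x * cl p + y * cl p' \<Longrightarrow>
      Q (Poly_Mapping.single p x + Poly_Mapping.single p' y)"
    and c: "Poly_Mapping.keys c \<subseteq> P" "n dvd wsum cl c"
  shows "Q c"
  using c
proof (induction "card (Poly_Mapping.keys c)" arbitrary: c rule: less_induct)
  case less
  show ?case
  proof (cases "Poly_Mapping.keys c = {}")
    case True
    then show ?thesis using zero by simp
  next
    case False
    then obtain r where r: "r \<in> Poly_Mapping.keys c" by blast
    define S where "S = Poly_Mapping.keys c - {r}"
    have S: "finite S" "Poly_Mapping.keys c = insert r S" "r \<notin> S" using r by (auto simp: S_def)
    let ?l = "Poly_Mapping.lookup c"
    have ws: "wsum cl c = ?l r * cl r + (\<Sum>i\<in>S. ?l i * cl i)"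
      using S by (simp add: wsum_def)
    show ?thesis
    proof (cases "S = {}")
      case True
      \<comment> \<open>A support of one prime is treated as the degenerate pair of \<open>r\<close>
        with itself.\<close>
      have "c = Poly_Mapping.single r (?l r) + Poly_Mapping.single r 0"
        using S True by (intro poly_mapping_eqI) (auto simp: lookup_add lookup_single when_def in_keys_iff)
      moreover have "n dvd ?l r * cl r + 0 * cl r" using less.prems ws True by simp
      ultimately show ?thesis using pair[of r r "?l r" 0] less.prems r by auto
    next
      case False
      have "n dvd ?l r * cl r + (\<Sum>i\<in>S. ?l i * cl i)" using less.prems ws by simp
      from split_zero_sum[OF S(1) False n this] obtain s t where
        st: "?l r = (\<Sum>i\<in>S. s i)" "\<forall>i\<in>S. n dvd s i * cl r + t i * cl i" by blast
      define f where "f = (\<lambda>i. Poly_Mapping.single r (s i) + Poly_Mapping.single i (t i))"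
      have Qf: "Q (\<Sum>i\<in>S'. f i)" if "S' \<subseteq> S" for S'
        using finite_subset[OF that S(1)] that
      proof (induction S' rule: finite_induct)
        case (insert i S')
        then have "Q (f i)" unfolding f_def using st S less.prems by (intro pair) auto
        then show ?case using insert by (simp add: add)
      qed (simp add: zero)
      \<comment> \<open>The pairs use up the coefficient of \<open>r\<close> exactly, so the support
        of \<open>c'\<close> lies in \<open>S\<close>. Its coefficients may become negative, which
        is why the induction runs over integer vectors instead of blocks.\<close>
      define c' where "c' = c - (\<Sum>i\<in>S. f i)"
      have lf: "Poly_Mapping.lookup (\<Sum>i\<in>S. f i) j = (\<Sum>i\<in>S. Poly_Mapping.lookup (f i) j)" for j
        by (simp add: lookup_sum)
      have "(\<Sum>i\<in>S. Poly_Mapping.lookup (f i) r) = (\<Sum>i\<in>S. s i)"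
        using S by (intro sum.cong) (auto simp: f_def lookup_add lookup_single when_def)
      then have "Poly_Mapping.lookup c' r = 0" using st by (simp add: c'_def lookup_minus lf)
      moreover have "Poly_Mapping.lookup c' j = 0" if "j \<notin> insert r S" for j
      proof -
        have "?l j = 0" using that S by (metis in_keys_iff)
        moreover have "(\<Sum>i\<in>S. Poly_Mapping.lookup (f i) j) = 0"
          using that by (intro sum.neutral) (auto simp: f_def lookup_add lookup_single when_def)
        ultimately show ?thesis by (simp add: c'_def lookup_minus lf)
      qed
      ultimately have keys: "Poly_Mapping.keys c' \<subseteq> S" by (metis in_keys_iff insertE subsetI)
      then have "card (Poly_Mapping.keys c') \<le> card S" using S by (intro card_mono)
      also have "\<dots> < card (Poly_Mapping.keys c)" using S by simp
      finally have card: "card (Poly_Mapping.keys c') < card (Poly_Mapping.keys c)" .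
      have "n dvd (\<Sum>i\<in>S. wsum cl (f i))"
        using st by (intro dvd_sum) (auto simp: f_def wsum_add)
      then have "n dvd wsum cl c'" using less.prems by (simp add: c'_def wsum_diff wsum_sum)
      then have "Q c'" using less.hyps[OF card] keys less.prems S by auto
      then have "Q (c' + (\<Sum>i\<in>S. f i))" using Qf[of S] by (simp add: add)
      then show ?thesis by (simp add: c'_def)
    qed
  qed
qed

section \<open>Blocks and their atoms\<close>

locale zero_sum_monoid =
  fixes P :: "'p set" and cl :: "'p \<Rightarrow> int" and n :: int
  assumes n_pos: "n > 0"
begin

definition block :: "('p \<Rightarrow>\<^sub>0 int) \<Rightarrow> bool" where
  "block c \<longleftrightarrow> Poly_Mapping.keys c \<subseteq> P \<and> (\<forall>p. 0 \<le> Poly_Mapping.lookup c p) \<and> n dvd wsum cl c"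

definition block_atom :: "('p \<Rightarrow>\<^sub>0 int) \<Rightarrow> bool" where
  "block_atom c \<longleftrightarrow> block c \<and> c \<noteq> 0 \<and>
     (\<forall>u v. block u \<longrightarrow> block v \<longrightarrow> c = u + v \<longrightarrow> u = 0 \<or> v = 0)"

lemma block_0 [simp]: "block 0"
  by (simp add: block_def)

lemma block_add: "block b \<Longrightarrow> block c \<Longrightarrow> block (b + c)"
  using Poly_Mapping.keys_add[of b c] unfolding block_def
  by (auto simp: lookup_add wsum_add)

lemma block_diff:
  assumes "block b" "block c" "\<And>p. Poly_Mapping.lookup b p \<le> Poly_Mapping.lookup c p"
  shows "block (c - b)"
  using assms Poly_Mapping.keys_diff[of c b] unfolding block_def
  by (auto simp: lookup_minus wsum_diff)

lemma block_atom_minimal: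
  assumes "block_atom c" "block b" "b \<noteq> 0" "\<And>p. Poly_Mapping.lookup b p \<le> Poly_Mapping.lookup c p"
  shows "b = c"
proof -
  have "block (c - b)" using assms by (intro block_diff) (auto simp: block_atom_def)
  moreover have "c = b + (c - b)" by simp
  ultimately have "b = 0 \<or> c - b = 0" using assms unfolding block_atom_def by blast
  then show ?thesis using assms by simp
qed

lemma block_atomI:
  assumes "block c" "c \<noteq> 0"
    and "\<And>b. block b \<Longrightarrow> b \<noteq> 0 \<Longrightarrow> (\<And>p. Poly_Mapping.lookup b p \<le> Poly_Mapping.lookup c p) \<Longrightarrow> b = c"
  shows "block_atom c"
  unfolding block_atom_def
proof (intro conjI allI impI)
  fix u v assume uv: "block u" "block v" "c = u + v"
  have "Poly_Mapping.lookup u p \<le> Poly_Mapping.lookup c p" for p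
    using uv by (simp add: lookup_add block_def)
  then have "u = 0 \<or> u = c" using assms(3) uv by blast
  then show "u = 0 \<or> v = 0" using uv by auto
qed (use assms in auto)

section \<open>Orders of classes\<close>

definition ordr :: "'p \<Rightarrow> int" where "ordr p = n div gcd (cl p) n"

text \<open>The class of \<open>p\<close> is \<open>unitpart p\<close> times
  \<open>n div ordr p\<close>, the standard generator of the subgroup of order
  \<open>ordr p\<close>; the factor is a unit modulo \<open>ordr p\<close>.\<close>

definition unitpart :: "'p \<Rightarrow> int" where "unitpart p = cl p div gcd (cl p) n"

lemma ordr_mult_gcd: "ordr p * gcd (cl p) n = n"
  by (simp add: ordr_def)

lemma ordr_pos: "ordr p > 0"
  using n_pos unfolding ordr_def
  by (simp add: pos_imp_zdiv_pos_iff zdvd_imp_le)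

lemma ordr_dvd: "ordr p dvd n"
  by (metis ordr_mult_gcd dvd_triv_left)

lemma unitpart_mult_gcd: "unitpart p * gcd (cl p) n = cl p"
  by (simp add: unitpart_def)

lemma coprime_unitpart: "coprime (unitpart p) (ordr p)"
  unfolding unitpart_def ordr_def using n_pos by (intro div_gcd_coprime) auto

lemma ordr_mult_cl: "ordr p * cl p = n * unitpart p"
  by (metis unitpart_mult_gcd ordr_mult_gcd mult.assoc mult.commute)

lemma dvd_mult_cl_iff: "n dvd x * cl p \<longleftrightarrow> ordr p dvd x"
proof -
  have "n dvd x * cl p \<longleftrightarrow> ordr p * gcd (cl p) n dvd (x * unitpart p) * gcd (cl p) n"
    by (simp add: ordr_mult_gcd unitpart_mult_gcd mult.assoc)
  also have "\<dots> \<longleftrightarrow> ordr p dvd x * unitpart p" using n_pos by simp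
  also have "\<dots> \<longleftrightarrow> ordr p dvd x"
    by (metis coprime_unitpart coprime_commute coprime_dvd_mult_left_iff)
  finally show ?thesis .
qed

definition cross_number :: "('p \<Rightarrow>\<^sub>0 int) \<Rightarrow> real" where
  "cross_number = wsum (\<lambda>p. 1 / of_int (ordr p))"

section \<open>Zero-sum vectors supported on two primes\<close>

definition common_order :: "'p \<Rightarrow> 'p \<Rightarrow> int" where
  "common_order p p' = gcd (ordr p) (ordr p')"

text \<open>Every zero-sum vector on \<open>p\<close> and \<open>p'\<close> has coefficients
  divisible by these two cofactors. Dividing them out leaves a planar lattice of index
  \<open>common_order p p'\<close>, to which the analysis of pair blocks applies.\<close>

definition pair_vector :: "'p \<Rightarrow> 'p \<Rightarrow> int \<times> int \<Rightarrow> 'p \<Rightarrow>\<^sub>0 int" where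
  "pair_vector p p' U = Poly_Mapping.single p (fst U * (ordr p div common_order p p')) +
     Poly_Mapping.single p' (snd U * (ordr p' div common_order p p'))"

lemma common_order_commute: "common_order p p' = common_order p' p"
  by (simp add: common_order_def gcd.commute)

lemma common_order_pos: "common_order p p' > 0"
  using ordr_pos[of p] by (simp add: common_order_def)

lemma ordr_div_pos: "ordr p div common_order p p' > 0"
  using ordr_pos[of p] common_order_pos[of p p']
  by (simp add: common_order_def pos_imp_zdiv_pos_iff zdvd_imp_le)

lemma ordr_div_mult: "(ordr p div common_order p p') * common_order p p' = ordr p"
  by (simp add: common_order_def)

lemma common_order_dvd: "common_order p p' dvd n"
  using ordr_dvd[of p] by (auto simp: common_order_def intro: dvd_trans)

lemma ordr_div_mult_cl:
  "(ordr p div common_order p p') * cl p = (n div common_order p p') * unitpart p"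
proof -
  have "common_order p p' * ((ordr p div common_order p p') * cl p) = ordr p * cl p"
    by (metis ordr_div_mult mult.assoc mult.commute)
  also have "\<dots> = common_order p p' * ((n div common_order p p') * unitpart p)"
    using common_order_dvd[of p p'] by (simp add: ordr_mult_cl flip: mult.assoc)
  finally show ?thesis using common_order_pos[of p p'] by simp
qed

lemma coprime_unitpart_common:
  "coprime (unitpart p) (common_order p p')" "coprime (unitpart p') (common_order p p')"
  by (rule coprime_divisors[OF dvd_refl _ coprime_unitpart], simp add: common_order_def)+

lemma lookup_pair_vector:
  assumes "p \<noteq> p'"
  shows "Poly_Mapping.lookup (pair_vector p p' U) p = fst U * (ordr p div common_order p p')"
    "Poly_Mapping.lookup (pair_vector p p' U) p' = snd U * (ordr p' div common_order p p')"
    "j \<noteq> p \<Longrightarrow> j \<noteq> p' \<Longrightarrow> Poly_Mapping.lookup (pair_vector p p' U) j = 0"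
  using assms by (auto simp: pair_vector_def lookup_add lookup_single when_def)

lemma pair_vector_add: "pair_vector p p' (x + y, z + w) = pair_vector p p' (x, z) + pair_vector p p' (y, w)"
  by (simp add: pair_vector_def algebra_simps single_add)

lemma pair_vector_eq_0_iff:
  assumes "p \<noteq> p'" shows "pair_vector p p' U = 0 \<longleftrightarrow> U = (0, 0)"
proof
  assume *: "pair_vector p p' U = 0"
  show "U = (0, 0)"
    using lookup_pair_vector(1,2)[OF assms, of U] ordr_div_pos[of p p'] ordr_div_pos[of p' p]
    unfolding * by (cases U) (auto simp: common_order_commute)
qed (simp add: pair_vector_def)

text \<open>The two cyclic groups generated by the classes of \<open>p\<close> and \<open>p'\<close> meet in a group of order
  \<open>common_order p p'\<close>.\<close>
lemma zero_sum_pair_dvd: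
  assumes "n dvd x * cl p + y * cl p'"
  shows "(ordr p div common_order p p') dvd x"
proof -
  \<comment> \<open>Multiplying by \<open>ordr p'\<close> kills the second class; what remains is
    cleared by the coprimality of the two cofactors of the common order.\<close>
  have "n dvd ordr p' * (x * cl p + y * cl p')" using assms by simp
  also have "ordr p' * (x * cl p + y * cl p') = (ordr p' * x) * cl p + y * (ordr p' * cl p')"
    by (simp add: algebra_simps)
  also have "\<dots> = (ordr p' * x) * cl p + n * (y * unitpart p')" by (simp add: ordr_mult_cl)
  finally have "ordr p dvd ordr p' * x"
    using dvd_mult_cl_iff by (metis dvd_add_left_iff dvd_triv_left)
  then have "(ordr p div common_order p p') * common_order p p' dvd
      (ordr p' div common_order p p') * x * common_order p p'"
    using ordr_div_mult[of p p'] ordr_div_mult[of p' p]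
    by (simp add: common_order_commute[of p' p] mult.commute mult.left_commute)
  then have "(ordr p div common_order p p') dvd (ordr p' div common_order p p') * x"
    using common_order_pos[of p p'] by simp
  moreover have "coprime (ordr p div common_order p p') (ordr p' div common_order p p')"
    unfolding common_order_def using ordr_pos[of p] by (intro div_gcd_coprime) auto
  ultimately show ?thesis by (simp add: coprime_dvd_mult_right_iff)
qed

lemma wsum_pair_vector:
  "wsum cl (pair_vector p p' (X, Y)) = (n div common_order p p') * (unitpart p * X + unitpart p' * Y)"
proof -
  have "wsum cl (pair_vector p p' (X, Y)) = X * ((ordr p div common_order p p') * cl p)
      + Y * ((ordr p' div common_order p p') * cl p')"
    by (simp add: pair_vector_def wsum_add mult.assoc)
  also have "\<dots> = (n div common_order p p') * (unitpart p * X + unitpart p' * Y)"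
    using ordr_div_mult_cl[of p p'] ordr_div_mult_cl[of p' p]
    by (simp add: common_order_commute[of p' p] algebra_simps)
  finally show ?thesis .
qed

lemma cross_number_pair_vector:
  "cross_number (pair_vector p p' (X, Y)) = (X + Y) / common_order p p'"
proof -
  have *: "real_of_int (ordr p div common_order p p') / real_of_int (ordr p) = 1 / common_order p p'" for p p'
  proof -
    have "real_of_int (ordr p) = (ordr p div common_order p p') * real_of_int (common_order p p')"
      by (metis ordr_div_mult of_int_mult)
    then show ?thesis
      using ordr_div_pos[of p p'] common_order_pos[of p p'] by (simp add: field_simps)
  qed
  have "cross_number (pair_vector p p' (X, Y)) =
      X * (real_of_int (ordr p div common_order p p') / ordr p) +
      Y * (real_of_int (ordr p' div common_order p' p) / ordr p')"
    by (simp add: cross_number_def pair_vector_def wsum_add common_order_commute[of p' p])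
  then show ?thesis unfolding * by (simp add: common_order_commute[of p' p] add_divide_distrib)
qed

text \<open>The hypothesis makes \<open>e\<close> the quotient of the two unit parts modulo the
  common order, so the unit \<open>unitpart p'\<close> can be factored out of the
  congruence.\<close>

lemma dvd_wsum_pair_vector_iff:
  assumes e: "common_order p p' dvd unitpart p - e * unitpart p'"
  shows "n dvd wsum cl (pair_vector p p' (X, Y)) \<longleftrightarrow> common_order p p' dvd e * X + Y"
proof -
  let ?N = "common_order p p'"
  have nN: "n div ?N \<noteq> 0" using common_order_dvd[of p p'] n_pos by (metis dvd_div_eq_0_iff less_irrefl)
  have "n dvd wsum cl (pair_vector p p' (X, Y)) \<longleftrightarrow>
      (n div ?N) * ?N dvd (n div ?N) * (unitpart p * X + unitpart p' * Y)"
    using common_order_dvd by (simp add: wsum_pair_vector)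
  also have "\<dots> \<longleftrightarrow> ?N dvd unitpart p * X + unitpart p' * Y"
    using nN by simp
  also have "unitpart p * X + unitpart p' * Y =
      X * (unitpart p - e * unitpart p') + unitpart p' * (e * X + Y)" by (simp add: algebra_simps)
  also have "?N dvd \<dots> \<longleftrightarrow> ?N dvd unitpart p' * (e * X + Y)"
    using e by (intro dvd_add_right_iff) simp
  also have "\<dots> \<longleftrightarrow> ?N dvd e * X + Y"
    by (rule coprime_dvd_mult_right_iff)
      (metis coprime_unitpart_common(2) coprime_commute)
  finally show ?thesis .
qed

lemma block_pair_vector_iff:
  assumes "p \<in> P" "p' \<in> P" "p \<noteq> p'" and e: "common_order p p' dvd unitpart p - e * unitpart p'"
  shows "block (pair_vector p p' U) \<longleftrightarrow> pair_block (common_order p p') e U"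
proof -
  have "Poly_Mapping.keys (pair_vector p p' U) \<subseteq> {p, p'}"
    by (metis assms(3) in_keys_iff insertCI lookup_pair_vector(3) subsetI)
  then have "Poly_Mapping.keys (pair_vector p p' U) \<subseteq> P" using assms by blast
  moreover have "(\<forall>j. 0 \<le> Poly_Mapping.lookup (pair_vector p p' U) j) \<longleftrightarrow> 0 \<le> fst U \<and> 0 \<le> snd U"
  proof -
    have "(\<forall>j. 0 \<le> Poly_Mapping.lookup (pair_vector p p' U) j) \<longleftrightarrow>
        0 \<le> Poly_Mapping.lookup (pair_vector p p' U) p \<and> 0 \<le> Poly_Mapping.lookup (pair_vector p p' U) p'"
      using lookup_pair_vector(3)[OF assms(3)] by (metis order_refl)
    also have "\<dots> \<longleftrightarrow> 0 \<le> fst U \<and> 0 \<le> snd U"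
      using lookup_pair_vector(1,2)[OF assms(3), of U] ordr_div_pos[of p p'] ordr_div_pos[of p' p]
      by (simp add: common_order_commute[of p' p] zero_le_mult_iff)
    finally show ?thesis .
  qed
  moreover have "n dvd wsum cl (pair_vector p p' U) \<longleftrightarrow> common_order p p' dvd e * fst U + snd U"
    using dvd_wsum_pair_vector_iff[OF e, of "fst U" "snd U"] by simp
  ultimately show ?thesis unfolding block_def pair_block_def by blast
qed

lemma pair_vector_surj:
  assumes "p \<noteq> p'" "block b" "Poly_Mapping.keys b \<subseteq> {p, p'}"
  shows "\<exists>U. b = pair_vector p p' U"
proof -
  let ?x = "Poly_Mapping.lookup b p" and ?y = "Poly_Mapping.lookup b p'"
  have "wsum cl b = ?x * cl p + ?y * cl p'"
    using assms wsum_superset[of "{p, p'}" b cl] by simp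
  then have "n dvd ?x * cl p + ?y * cl p'" "n dvd ?y * cl p' + ?x * cl p"
    using assms by (auto simp: block_def add.commute)
  then obtain X Y where XY: "?x = X * (ordr p div common_order p p')" "?y = Y * (ordr p' div common_order p p')"
    by (metis zero_sum_pair_dvd common_order_commute dvdE mult.commute)
  have "b = pair_vector p p' (X, Y)"
  proof (rule poly_mapping_eqI)
    fix j
    consider "j = p" | "j = p'" | "j \<notin> {p, p'}" by blast
    then show "Poly_Mapping.lookup b j = Poly_Mapping.lookup (pair_vector p p' (X, Y)) j"
    proof cases
      case 3
      then have "Poly_Mapping.lookup b j = 0" using assms(3) by (metis in_keys_iff subsetD)
      then show ?thesis using 3 lookup_pair_vector(3)[OF assms(1)] by simp
    qed (use XY lookup_pair_vector(1,2)[OF assms(1)] in auto)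
  qed
  then show ?thesis ..
qed

text \<open>A block below a pair vector is supported on the same two primes and is therefore a pair
  vector itself, so minimality in the plane is minimality among all blocks.\<close>

lemma block_atom_pair_vector:
  assumes pp: "p \<in> P" "p' \<in> P" "p \<noteq> p'" and e: "common_order p p' dvd unitpart p - e * unitpart p'"
    and U: "pair_atom (common_order p p') e U"
  shows "block_atom (pair_vector p p' U)"
proof (rule block_atomI)
  show "block (pair_vector p p' U)" using block_pair_vector_iff[OF pp e] U by (simp add: pair_atom_def)
  show "pair_vector p p' U \<noteq> 0" using U pp by (simp add: pair_vector_eq_0_iff pair_atom_def)
  fix b assume b: "block b" "b \<noteq> 0"
    "\<And>j. Poly_Mapping.lookup b j \<le> Poly_Mapping.lookup (pair_vector p p' U) j"
  have "Poly_Mapping.lookup b j = 0" if "j \<notin> {p, p'}" for j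
    using b(1) b(3)[of j] that lookup_pair_vector(3)[OF pp(3), of j U] by (simp add: block_def order_antisym)
  then have "Poly_Mapping.keys b \<subseteq> {p, p'}" by (meson in_keys_iff subsetI)
  then obtain V where V: "b = pair_vector p p' V" using pair_vector_surj[OF pp(3) b(1)] by blast
  have "fst V \<le> fst U" "snd V \<le> snd U"
    using b(3)[of p] b(3)[of p'] lookup_pair_vector(1,2)[OF pp(3)] ordr_div_pos[of p p'] ordr_div_pos[of p' p]
    by (auto simp: V common_order_commute[of p' p])
  moreover have "V \<noteq> (0, 0)" using b(2) pp by (simp add: V pair_vector_eq_0_iff)
  moreover have "pair_block (common_order p p') e V"
    using b(1) block_pair_vector_iff[OF pp e] by (simp add: V)
  ultimately have "V = U" using U unfolding pair_atom_def by blast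
  then show "b = pair_vector p p' U" by (simp add: V)
qed

lemma block_atom_single:
  assumes "p \<in> P"
  shows "block_atom (Poly_Mapping.single p (ordr p))"
proof (rule block_atomI)
  show "block (Poly_Mapping.single p (ordr p))"
    using assms ordr_pos[of p] by (auto simp: block_def lookup_single when_def ordr_mult_cl)
  show "Poly_Mapping.single p (ordr p) \<noteq> 0" using ordr_pos[of p] by (metis less_irrefl lookup_single_eq lookup_zero)
  fix b assume b: "block b" "b \<noteq> 0"
    "\<And>j. Poly_Mapping.lookup b j \<le> Poly_Mapping.lookup (Poly_Mapping.single p (ordr p)) j"
  have l0: "Poly_Mapping.lookup b j = 0" if "j \<noteq> p" for j
    using b(1) b(3)[of j] that by (simp add: block_def order_antisym lookup_single when_def)
  then have bs: "b = Poly_Mapping.single p (Poly_Mapping.lookup b p)"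
    by (intro poly_mapping_eqI) (auto simp: lookup_single when_def)
  then have "wsum cl b = Poly_Mapping.lookup b p * cl p" by (metis wsum_single of_int_eq_id id_apply)
  then have "ordr p dvd Poly_Mapping.lookup b p" using b(1) by (simp add: block_def dvd_mult_cl_iff)
  moreover have "Poly_Mapping.lookup b p \<noteq> 0" using bs b(2) by (metis single_zero)
  then have "Poly_Mapping.lookup b p > 0" using b(1) by (simp add: block_def less_le)
  ultimately have "Poly_Mapping.lookup b p = ordr p"
    using b(3)[of p] zdvd_imp_le[of "ordr p" "Poly_Mapping.lookup b p"] by simp
  then show "b = Poly_Mapping.single p (ordr p)" using bs by metis
qed

end

section \<open>Divisibility chains\<close>

text \<open>Lower by one the coefficient at the largest \<open>r i\<close> with
  \<open>x i > 0\<close>. By the chain condition \<open>r i\<close> is a common denominator, so a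
  sum above 1 is at least \<open>1 + 1 / r i\<close> and cannot jump over 1.\<close>

lemma chain_subsum_eq_1:
  fixes r x :: "'p \<Rightarrow> int"
  assumes "finite F" "\<And>i. i \<in> F \<Longrightarrow> r i > 0" "\<And>i. i \<in> F \<Longrightarrow> x i \<ge> 0"
    and chain: "\<And>i j. i \<in> F \<Longrightarrow> j \<in> F \<Longrightarrow> r i dvd r j \<or> r j dvd r i"
    and ge1: "(\<Sum>i\<in>F. x i / r i :: real) \<ge> 1"
  shows "\<exists>y. (\<forall>i\<in>F. 0 \<le> y i \<and> y i \<le> x i) \<and> (\<Sum>i\<in>F. y i / r i :: real) = 1"
  using assms(3) ge1
proof (induction "nat (\<Sum>i\<in>F. x i)" arbitrary: x rule: less_induct)
  case less
  show ?case
  proof (cases "(\<Sum>i\<in>F. x i / r i :: real) = 1")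
    case True
    then show ?thesis using less.prems by (intro exI[of _ x]) auto
  next
    case False
    define A where "A = {i \<in> F. x i > 0}"
    have A: "finite A" "A \<subseteq> F" using assms(1) by (auto simp: A_def)
    have zero: "x i = 0" if "i \<in> F - A" for i
      using less.prems(1)[of i] that by (force simp: A_def)
    have "A \<noteq> {}"
    proof
      assume "A = {}"
      then have "(\<Sum>i\<in>F. x i / r i :: real) = 0" using zero by (intro sum.neutral) auto
      then show False using less.prems by simp
    qed
    define m where "m = Max (r ` A)"
    have "m \<in> r ` A" unfolding m_def using A \<open>A \<noteq> {}\<close> by (intro Max_in) auto
    then obtain i where i: "i \<in> A" "r i = m" by blast
    have rm: "r j dvd r i" if "j \<in> A" for j
    proof -
      have "r j \<le> r i" unfolding i m_def using A that by (intro Max_ge) auto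
      then show ?thesis using chain[of j i] that i A assms(2)[of j] zdvd_imp_le[of "r i" "r j"] by force
    qed
    have r0: "r i > 0" using i A assms(2) by auto
    have split: "(\<Sum>j\<in>F. z j) = (\<Sum>j\<in>F - {i}. z j) + z i" for z :: "'p \<Rightarrow> 'b::comm_ring_1"
      using assms(1) i A by (subst sum.remove[of F i]) auto
    have "(\<Sum>j\<in>F. x j / r j :: real) = (\<Sum>j\<in>F. of_int (x j * (r i div r j)) / r i)"
    proof (rule sum.cong)
      fix j assume j: "j \<in> F"
      show "(x j / r j :: real) = of_int (x j * (r i div r j)) / r i"
      proof (cases "j \<in> A")
        case True
        then show ?thesis using rm[of j] assms(2)[of j] j r0 by (auto simp: field_simps real_of_int_div)
      qed (use zero j in auto)
    qed auto
    also have "\<dots> = of_int (\<Sum>j\<in>F. x j * (r i div r j)) / r i"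
      by (simp add: sum_divide_distrib)
    finally obtain K :: int where K: "(\<Sum>j\<in>F. x j / r j :: real) = K / r i" by blast
    have "K / r i > (1::real)" using False less.prems(2) unfolding K by linarith
    then have "K \<ge> r i + 1" using r0 by (simp add: field_simps)
    then have "(K - 1) / r i \<ge> (1::real)" using r0 by (simp add: field_simps)
    moreover define x' where "x' = x(i := x i - 1)"
    have eqs: "(\<Sum>j\<in>F - {i}. x' j / r j :: real) = (\<Sum>j\<in>F - {i}. x j / r j)"
      "(\<Sum>j\<in>F - {i}. x' j) = (\<Sum>j\<in>F - {i}. x j)"
      by (auto simp: x'_def intro: sum.cong)
    have "(\<Sum>j\<in>F. x' j / r j :: real) = (K - 1) / r i"
      using K unfolding split[of "\<lambda>j. x' j / r j :: real"] split[of "\<lambda>j. x j / r j :: real"] eqs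
      by (simp add: x'_def diff_divide_distrib)
    ultimately have ge: "(\<Sum>j\<in>F. x' j / r j :: real) \<ge> 1" by simp
    have pos: "x' j \<ge> 0" if "j \<in> F" for j using less.prems(1)[OF that] i by (auto simp: x'_def A_def)
    have "(\<Sum>j\<in>F. x' j) < (\<Sum>j\<in>F. x j)"
      unfolding split[of x'] split[of x] eqs by (simp add: x'_def)
    moreover have "(\<Sum>j\<in>F. x' j) \<ge> 0" using pos by (intro sum_nonneg)
    ultimately have "nat (\<Sum>j\<in>F. x' j) < nat (\<Sum>j\<in>F. x j)" by simp
    from less.hyps[OF this pos ge] obtain y where
      y: "\<forall>j\<in>F. 0 \<le> y j \<and> y j \<le> x' j" "(\<Sum>j\<in>F. y j / r j :: real) = 1" by blast
    moreover have "x' j \<le> x j" for j by (simp add: x'_def)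
    ultimately show ?thesis by (meson order_trans)
  qed
qed

text \<open>A divisor prime to \<open>r\<close> and its complementary divisor are distinguished by divisibility
  by \<open>r\<close>, so the smaller of the two determines the divisor.\<close>
lemma card_divisors_prime_to:
  fixes r n d :: int
  assumes n: "n > 0" "n < d * d" "d > 0" and r: "r dvd n" "Factorial_Ring.prime r"
    and E: "\<And>e. e \<in> E \<Longrightarrow> e > 0 \<and> e dvd n \<and> \<not> r dvd e"
  shows "int (card E) \<le> d - 1"
proof -
  define f where "f = (\<lambda>e. min e (n div e))"
  have rc: "r dvd n div e" if "e \<in> E" for e
  proof -
    have "r dvd e * (n div e)" using E[OF that] r by simp
    then show ?thesis using prime_dvd_multD[OF r(2)] E[OF that] by blast
  qed
  have inj: "inj_on f E"
  proof (rule inj_onI)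
    fix e e' assume e: "e \<in> E" "e' \<in> E" "f e = f e'"

    \<comment> \<open>The two mixed cases are impossible because \<open>r\<close> divides every
      complementary divisor but no element of \<open>E\<close>.\<close>
    consider "e = e'" | "e = n div e'" | "n div e = e'" | "n div e = n div e'"
      using e(3) by (auto simp: f_def min_def split: if_splits)
    then show "e = e'"
    proof cases
      case 4
      have "e * (n div e) = e' * (n div e')" using E[OF e(1)] E[OF e(2)] by simp
      moreover have "n div e' \<noteq> 0" using E[OF e(2)] n by (auto simp: dvd_div_eq_0_iff)
      ultimately show ?thesis using 4 by simp
    qed (use rc E e in auto)
  qed
  have range: "f ` E \<subseteq> {1..d - 1}"
  proof
    fix x assume "x \<in> f ` E"
    then obtain e where e: "e \<in> E" "x = f e" by blast
    have pos: "e > 0" "n div e > 0" "e * (n div e) = n"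
      using E[OF e(1)] n by (auto simp: pos_imp_zdiv_pos_iff zdvd_imp_le)
    \<comment> \<open>The smaller of two complementary divisors has square at most
      \<open>n < d * d\<close>, which leaves only \<open>d - 1\<close> values.\<close>
    have "x * x \<le> e * (n div e)" using pos unfolding e f_def by (intro mult_mono) auto
    then have "x * x < d * d" using pos n by simp
    then have "x < d" using n(3) by (smt (verit) mult_mono)
    moreover have "x \<ge> 1" using pos unfolding e f_def by auto
    ultimately show "x \<in> {1..d - 1}" by simp
  qed
  have "card E = card (f ` E)" using inj by (simp add: card_image)
  also have "\<dots> \<le> card {1..d - 1}" using range by (intro card_mono) auto
  finally show "int (card E) \<le> d - 1" using n by simp
qed

section \<open>Cross numbers\<close>

context zero_sum_monoid
begin

text \<open>Only the total cross number has to match the difference of lengths. The property is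
  additive and stable under negation, so it passes from zero-sum pairs to all zero-sum vectors,
  including those with negative coefficients.\<close>

definition atomic_difference :: "('p \<Rightarrow>\<^sub>0 int) \<Rightarrow> bool" where
  "atomic_difference c \<longleftrightarrow> (\<exists>us vs. (\<forall>a\<in>set us \<union> set vs. block_atom a) \<and>
     c = sum_list us - sum_list vs \<and> cross_number c = real (length us) - real (length vs))"

definition length_congruent :: "int \<Rightarrow> bool" where
  "length_congruent d \<longleftrightarrow> (\<forall>us vs. (\<forall>a\<in>set us \<union> set vs. block_atom a) \<longrightarrow>
     sum_list us = sum_list vs \<longrightarrow> d dvd int (length us) - int (length vs))"

lemma cross_number_add: "cross_number (b + c) = cross_number b + cross_number c"
  by (simp add: cross_number_def wsum_add)

lemma cross_number_uminus: "cross_number (- c) = - cross_number c"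
  by (simp add: cross_number_def wsum_uminus)

lemma atomic_difference_0: "atomic_difference 0"
  unfolding atomic_difference_def
  by (intro exI[of _ "[]"]) (simp add: cross_number_def)

lemma atomic_difference_add:
  assumes "atomic_difference b" "atomic_difference c"
  shows "atomic_difference (b + c)"
proof -
  obtain us vs us' vs' where *: "\<forall>a\<in>set us \<union> set vs. block_atom a" "b = sum_list us - sum_list vs"
    "cross_number b = real (length us) - real (length vs)"
    "\<forall>a\<in>set us' \<union> set vs'. block_atom a" "c = sum_list us' - sum_list vs'"
    "cross_number c = real (length us') - real (length vs')"
    using assms unfolding atomic_difference_def by blast
  have "\<forall>a\<in>set (us @ us') \<union> set (vs @ vs'). block_atom a" using *(1,4) by auto
  moreover have "b + c = sum_list (us @ us') - sum_list (vs @ vs')" using * by simp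
  moreover have "cross_number (b + c) = real (length (us @ us')) - real (length (vs @ vs'))"
    using * by (simp add: cross_number_add)
  ultimately show ?thesis unfolding atomic_difference_def by blast
qed

lemma atomic_difference_uminus:
  assumes "atomic_difference c" shows "atomic_difference (- c)"
proof -
  obtain us vs where *: "\<forall>a\<in>set us \<union> set vs. block_atom a" "c = sum_list us - sum_list vs"
    "cross_number c = real (length us) - real (length vs)"
    using assms unfolding atomic_difference_def by blast
  have "- c = sum_list vs - sum_list us" using * by simp
  moreover have "cross_number (- c) = real (length vs) - real (length us)"
    unfolding cross_number_uminus using *(3) by simp
  ultimately show ?thesis using *(1) unfolding atomic_difference_def by blast
qed

lemma atomic_difference_cmul:
  assumes "atomic_difference c" shows "atomic_difference (frag_cmul k c)"
proof (induction k rule: int_induct[where k = 0])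
  case (step1 i)
  then show ?case using assms by (simp add: frag_cmul_distrib atomic_difference_add)
next
  case (step2 i)
  have "frag_cmul (i - 1) c = frag_cmul i c + - c"
    by (intro poly_mapping_eqI) (simp add: lookup_add lookup_minus algebra_simps)
  then show ?case using step2 assms by (simp add: atomic_difference_add atomic_difference_uminus del: add_uminus_conv_diff)
qed (simp add: atomic_difference_0)

lemma atomic_difference_atom:
  assumes "block_atom c" "cross_number c = 1" shows "atomic_difference c"
proof -
  have "\<forall>a\<in>set [c] \<union> set []. block_atom a" "c = sum_list [c] - sum_list []"
    "cross_number c = real (length [c]) - real (length [])"
    using assms by auto
  then show ?thesis unfolding atomic_difference_def by blast
qed

lemma cross_number_single: "cross_number (Poly_Mapping.single p (ordr p)) = 1"
  using ordr_pos[of p] by (simp add: cross_number_def)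

lemma pair_vector_replicate:
  "sum_list (replicate k (pair_vector p p' U)) = pair_vector p p' (int k * fst U, int k * snd U)"
proof (induction k)
  case (Suc k)
  have "pair_vector p p' (int (Suc k) * fst U, int (Suc k) * snd U) =
      pair_vector p p' (fst U + int k * fst U, snd U + int k * snd U)"
    by (simp add: algebra_simps)
  then show ?case using Suc by (simp add: pair_vector_add)
qed (simp add: pair_vector_def)

text \<open>The two sides of \<open>t V = U + R\<close> become two factorizations of one block, of
  lengths \<open>t\<close> and 2.\<close>

lemma turn_condition_common_order:
  assumes pp: "p \<in> P" "p' \<in> P" "p \<noteq> p'" and e: "common_order p p' dvd unitpart p - e * unitpart p'"
    and d: "length_congruent d"
  shows "turn_condition d (common_order p p') e"
  unfolding turn_condition_def
proof (intro allI impI)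
  fix U V t
  assume atoms: "pair_atom (common_order p p') e U" "pair_atom (common_order p p') e V"
    "pair_atom (common_order p p') e (next_record t U V)"
  \<comment> \<open>Positivity makes \<open>replicate (nat t)\<close> meaningful. For
    \<open>t \<le> 0\<close> the nonnegativity of \<open>t V - U\<close> would force
    \<open>U\<close> to vanish.\<close>
  have t: "t > 0"
  proof (rule ccontr)
    assume "\<not> t > 0"
    then have "t * fst V \<le> 0" "t * snd V \<le> 0"
      using atoms(2) by (auto simp: pair_atom_def pair_block_def mult_le_0_iff)
    then have "fst U = 0" "snd U = 0"
      using atoms(1,3) by (auto simp: pair_atom_def pair_block_def next_record_def)
    then show False using atoms(1) by (auto simp: pair_atom_def prod_eq_iff)
  qed
  let ?v = "pair_vector p p'"
  have "sum_list (replicate (nat t) (?v V)) = ?v (fst U + fst (next_record t U V), snd U + snd (next_record t U V))"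
    using t by (simp add: pair_vector_replicate next_record_def)
  also have "\<dots> = sum_list [?v U, ?v (next_record t U V)]"
    by (simp add: pair_vector_add)
  finally have "sum_list (replicate (nat t) (?v V)) = sum_list [?v U, ?v (next_record t U V)]" .
  moreover have "\<forall>a\<in>set (replicate (nat t) (?v V)) \<union> set [?v U, ?v (next_record t U V)]. block_atom a"
    using block_atom_pair_vector[OF pp e] atoms by auto
  ultimately have "d dvd int (length (replicate (nat t) (?v V))) - int (length [?v U, ?v (next_record t U V)])"
    using d unfolding length_congruent_def by blast
  then show "d dvd t - 2" using t by simp
qed

text \<open>Let \<open>e\<close> be the quotient of the unit parts modulo the common order.
  Incongruence means that the initial gap \<open>e\<close> of the continued fraction is not 1, so it
  has a bend and the determinant formula applies.\<close>

lemma incongruent_pair: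
  assumes pp: "p \<in> P" "p' \<in> P" and d: "length_congruent d" "d > 0" "n < d * d"
    and incong: "\<not> common_order p p' dvd unitpart p - unitpart p'"
  shows "\<exists>c1 c2 q. c1 > 0 \<and> c2 > 0 \<and> q > 0 \<and> d dvd q \<and> common_order p p' = c1 + c2 + q * c1 * c2"
proof -
  let ?N = "common_order p p'"
  have ne: "p \<noteq> p'" using incong by auto
  have N: "?N > 0" by (rule common_order_pos)
  have "coprime (unitpart p') ?N" by (rule coprime_unitpart_common)
  then obtain v where v: "[unitpart p' * v = 1] (mod ?N)" using cong_solve_coprime_int by blast
  define e where "e = (unitpart p * v) mod ?N"
  have e: "?N dvd unitpart p - e * unitpart p'"
  proof -
    have "[e * unitpart p' = (unitpart p * v) * unitpart p'] (mod ?N)"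
      unfolding e_def by (intro cong_mult) (auto simp: cong_def)
    also have "(unitpart p * v) * unitpart p' = unitpart p * (unitpart p' * v)" by simp
    also have "[\<dots> = unitpart p * 1] (mod ?N)" using v by (intro cong_mult) auto
    finally show ?thesis by (simp add: cong_iff_dvd_diff dvd_diff_commute)
  qed
  have cop: "coprime e ?N"
  proof (rule coprimeI)
    fix g assume "g dvd e" "g dvd ?N"
    then have "g dvd (unitpart p - e * unitpart p') + e * unitpart p'"
      using e dvd_trans by (intro dvd_add) auto
    then have "g dvd unitpart p" by simp
    then show "is_unit g" using \<open>g dvd ?N\<close> coprime_unitpart_common(1)[of p p']
      by (meson coprime_common_divisor)
  qed
  have "e \<noteq> 1" using e incong by auto
  moreover have "e \<noteq> 0"
  proof
    assume "e = 0"
    then have "?N = 1" using cop N by simp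
    then show False using incong by simp
  qed
  moreover have "0 \<le> e" "e < ?N" using N by (auto simp: e_def)
  ultimately have "1 < e" "e < ?N" by auto
  moreover have "?N < d * d" using d common_order_dvd[of p p'] n_pos zdvd_imp_le[of ?N n] by linarith
  ultimately show ?thesis
    using pair_block_determinant[OF _ _ cop _ d(2) turn_condition_common_order[OF pp ne e d(1)]] by blast
qed

text \<open>This is the case in which \<open>e = 1\<close> works for every pair: the continued
  fractions have no bend, and the boundary vectors satisfy \<open>X + Y = N\<close>.\<close>

definition pairwise_congruent :: bool where
  "pairwise_congruent \<longleftrightarrow> (\<forall>p\<in>P. \<forall>p'\<in>P. common_order p p' dvd unitpart p - unitpart p')"

text \<open>For distinct primes the vectors \<open>(i, N - i)\<close>, where \<open>N\<close> is the
  common order, are atoms of cross number 1. Every pair with \<open>N dvd X + Y\<close> is one of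
  them plus integer multiples of \<open>(N, 0)\<close> and \<open>(0, N)\<close>. For equal primes
  the atom \<open>ordr p\<close> times \<open>p\<close> suffices.\<close>

lemma atomic_difference_pair:
  assumes cong: "pairwise_congruent" and pp: "p \<in> P" "p' \<in> P"
    and dvd: "n dvd x * cl p + y * cl p'"
  shows "atomic_difference (Poly_Mapping.single p x + Poly_Mapping.single p' y)"
proof (cases "p = p'")
  case True
  then have "ordr p dvd x + y" using dvd by (simp add: dvd_mult_cl_iff flip: distrib_right)
  then obtain k where "x + y = k * ordr p" by (metis dvdE mult.commute)
  then have "Poly_Mapping.single p x + Poly_Mapping.single p' y = frag_cmul k (Poly_Mapping.single p (ordr p))"
    using True by (intro poly_mapping_eqI) (simp add: lookup_single when_def flip: single_add)
  moreover have "atomic_difference (Poly_Mapping.single p (ordr p))"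
    using pp by (intro atomic_difference_atom block_atom_single cross_number_single)
  ultimately show ?thesis by (simp add: atomic_difference_cmul)
next
  case ne: False
  let ?N = "common_order p p'" and ?v = "pair_vector p p'"
  have N: "?N > 0" by (rule common_order_pos)
  have e: "?N dvd unitpart p - 1 * unitpart p'" using cong pp by (simp add: pairwise_congruent_def)
  have "(ordr p div ?N) dvd x" "(ordr p' div ?N) dvd y"
    using zero_sum_pair_dvd[OF dvd] zero_sum_pair_dvd[of y p' x p] dvd
    by (auto simp: add.commute common_order_commute[of p' p])
  then obtain X Y where XY: "x = X * (ordr p div ?N)" "y = Y * (ordr p' div ?N)"
    by (metis dvdE mult.commute)
  have eq: "Poly_Mapping.single p x + Poly_Mapping.single p' y = ?v (X, Y)"
    by (simp add: pair_vector_def XY)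
  have "wsum cl (?v (X, Y)) = x * cl p + y * cl p'" by (simp add: wsum_add flip: eq)
  then have "?N dvd X + Y" using dvd dvd_wsum_pair_vector_iff[OF e, of X Y] by simp
  have ad: "atomic_difference (?v (i, ?N - i))" if i: "0 \<le> i" "i \<le> ?N" for i
  proof (rule atomic_difference_atom)
    show "cross_number (?v (i, ?N - i)) = 1" using N by (simp add: cross_number_pair_vector)
    show "block_atom (?v (i, ?N - i))"
    proof (rule block_atom_pair_vector[OF pp ne e])
      show "pair_atom ?N 1 (i, ?N - i)"
        unfolding pair_atom_def pair_block_def
      proof (intro conjI allI impI)
        fix V :: "int \<times> int"
        assume V: "0 \<le> fst V \<and> 0 \<le> snd V \<and> ?N dvd 1 * fst V + snd V" "V \<noteq> (0, 0)"
          "fst V \<le> fst (i, ?N - i)" "snd V \<le> snd (i, ?N - i)"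
        then have "0 < fst V + snd V" by (cases V) auto
        then have "?N \<le> fst V + snd V" using V by (intro zdvd_imp_le) auto
        then show "V = (i, ?N - i)" using V by (cases V) auto
      qed (use i N in auto)
    qed
  qed
  define i where "i = X mod ?N"
  have i: "0 \<le> i" "i \<le> ?N" using N by (auto simp: i_def less_imp_le)
  obtain s where s: "X = i + ?N * s" by (metis i_def mod_mult_div_eq)
  have "?N dvd (X + Y) - ?N * (s + 1)" using \<open>?N dvd X + Y\<close> by simp
  also have "(X + Y) - ?N * (s + 1) = Y - (?N - i)" by (simp add: s algebra_simps)
  finally obtain r where r: "Y = (?N - i) + ?N * r" by (metis dvdE add.commute diff_add_cancel)
  have "?v (X, Y) = ?v (i, ?N - i) + ?v (?N * s, ?N * r)" unfolding s r by (rule pair_vector_add)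
  also have "?v (?N * s, ?N * r) = frag_cmul s (?v (?N, 0)) + frag_cmul r (?v (0, ?N))"
    by (intro poly_mapping_eqI) (simp add: pair_vector_def lookup_add lookup_single when_def)
  finally show ?thesis
    unfolding eq using ad[OF i] ad[of ?N] ad[of 0] N
    by (simp add: atomic_difference_add atomic_difference_cmul)
qed

text \<open>Writing \<open>c\<close> as a difference of atom sums \<open>us\<close> and
  \<open>vs\<close> gives two factorizations of the same block, \<open>us\<close> and
  \<open>c # vs\<close>; comparing their lengths modulo \<open>d\<close> yields the
  congruence.\<close>

lemma cross_number_atom_integer:
  assumes cong: "pairwise_congruent" and d: "length_congruent d" and c: "block_atom c"
  shows "\<exists>k::int. cross_number c = of_int k \<and> d dvd k - 1"
proof -
  have "atomic_difference c"
    by (rule zero_sum_generated_by_pairs[where P = P and cl = cl and n = n])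
      (use n_pos c atomic_difference_pair[OF cong] in
        \<open>auto simp: atomic_difference_0 atomic_difference_add block_atom_def block_def\<close>)
  then obtain us vs where *: "\<forall>a\<in>set us \<union> set vs. block_atom a" "c = sum_list us - sum_list vs"
    "cross_number c = real (length us) - real (length vs)"
    unfolding atomic_difference_def by blast
  have "\<forall>a\<in>set us \<union> set (c # vs). block_atom a" "sum_list us = sum_list (c # vs)"
    using * c by auto
  then have "d dvd int (length us) - int (length (c # vs))"
    using d unfolding length_congruent_def by blast
  then have "d dvd (int (length us) - int (length vs)) - 1" by (simp add: algebra_simps)
  moreover have "cross_number c = of_int (int (length us) - int (length vs))" using * by simp
  ultimately show ?thesis by blast
qed

text \<open>Part of the vector, supported on the chain, has cross number exactly 1. Along a chain
  all classes are multiples of one generator, so this part is already zero-sum, and by minimality it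
  is the whole atom.\<close>

lemma cross_number_chain:
  assumes cong: "pairwise_congruent" and c: "block_atom c" and F: "F \<subseteq> Poly_Mapping.keys c"
    and chain: "\<And>p p'. p \<in> F \<Longrightarrow> p' \<in> F \<Longrightarrow> ordr p dvd ordr p' \<or> ordr p' dvd ordr p"
    and ge1: "(\<Sum>p\<in>F. Poly_Mapping.lookup c p / ordr p :: real) \<ge> 1"
  shows "cross_number c = 1"
proof -
  have fin: "finite F" by (rule finite_subset[OF F]) simp
  have FP: "F \<subseteq> P" using F c by (auto simp: block_atom_def block_def)
  have c0: "0 \<le> Poly_Mapping.lookup c p" for p using c by (simp add: block_atom_def block_def)
  from chain_subsum_eq_1[OF fin ordr_pos c0 chain ge1] obtain y where
    y: "\<forall>p\<in>F. 0 \<le> y p \<and> y p \<le> Poly_Mapping.lookup c p"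
      "(\<Sum>p\<in>F. y p / ordr p :: real) = 1"
    by blast
  have "F \<noteq> {}" using y(2) by auto
  define b where "b = (\<Sum>p\<in>F. Poly_Mapping.single p (y p))"
  have lb: "Poly_Mapping.lookup b p = (if p \<in> F then y p else 0)" for p
    using fin by (simp add: b_def lookup_sum lookup_single when_def sum.delta)
  define m where "m = Max (ordr ` F)"
  have "m \<in> ordr ` F" unfolding m_def using fin \<open>F \<noteq> {}\<close> by (intro Max_in) auto
  then obtain t where t: "t \<in> F" "ordr t = m" by blast
  have om: "ordr p dvd ordr t" if "p \<in> F" for p
  proof -
    have "ordr p \<le> ordr t" unfolding t m_def using fin that by (intro Max_ge) auto
    then show ?thesis using chain[of p t] that t ordr_pos[of p] zdvd_imp_le[of "ordr t" "ordr p"] by force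
  qed
  \<comment> \<open>The common order with the top element \<open>t\<close> is \<open>ordr p\<close>
    itself, so pairwise congruence compares unit parts modulo \<open>ordr p\<close>; scaling by
    \<open>n div ordr p\<close> gives a congruence of classes modulo \<open>n\<close>.\<close>
  have cl: "n dvd cl p - unitpart t * (n div ordr p)" if "p \<in> F" for p
  proof -
    have "common_order p t = ordr p"
      using om[OF that] ordr_pos[of p] by (simp add: common_order_def)
    then have "ordr p dvd unitpart p - unitpart t"
      using cong that t FP by (metis pairwise_congruent_def subsetD)
    then have "ordr p * gcd (cl p) n dvd (unitpart p - unitpart t) * gcd (cl p) n" by simp
    moreover have "n div ordr p = gcd (cl p) n"
      using ordr_mult_gcd[of p] ordr_pos[of p] by (metis less_irrefl nonzero_mult_div_cancel_left)
    ultimately show ?thesis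
      by (simp add: ordr_mult_gcd left_diff_distrib unitpart_mult_gcd)
  qed
  have "real_of_int (\<Sum>p\<in>F. y p * (n div ordr p)) = n * (\<Sum>p\<in>F. y p / ordr p :: real)"
    using ordr_dvd by (simp add: sum_distrib_left real_of_int_div mult.commute)
  also have "\<dots> = n" using y by simp
  finally have sum_n: "(\<Sum>p\<in>F. y p * (n div ordr p)) = n" by linarith
  have "wsum cl b = (\<Sum>p\<in>F. y p * cl p)" by (simp add: b_def wsum_sum)
  also have "\<dots> = (\<Sum>p\<in>F. y p * (cl p - unitpart t * (n div ordr p)))
      + unitpart t * (\<Sum>p\<in>F. y p * (n div ordr p))"
    by (simp add: sum_distrib_left algebra_simps flip: sum.distrib)
  finally have "n dvd wsum cl b" using cl unfolding sum_n by (auto intro!: dvd_add dvd_sum)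
  moreover have "Poly_Mapping.keys b \<subseteq> F" using lb by (metis in_keys_iff subsetI)
  ultimately have "block b" using FP y lb by (auto simp: block_def)
  moreover have "b \<noteq> 0"
  proof
    assume "b = 0"
    then have "y p = 0" if "p \<in> F" for p using lb[of p] that by simp
    then show False using y(2) by simp
  qed
  moreover have "Poly_Mapping.lookup b p \<le> Poly_Mapping.lookup c p" for p using lb y c0 by simp
  ultimately have "b = c" using block_atom_minimal[OF c] by blast
  moreover have "cross_number b = 1" using y by (simp add: b_def cross_number_def wsum_sum)
  ultimately show ?thesis by simp
qed

lemma cross_number_pos:
  assumes "block c" "c \<noteq> 0" shows "cross_number c > 0"
proof -
  obtain p where p: "p \<in> Poly_Mapping.keys c" using assms(2) by fastforce
  have "Poly_Mapping.lookup c q * (1 / real_of_int (ordr q)) > 0" if "q \<in> Poly_Mapping.keys c" for q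
    using that assms(1) ordr_pos[of q] unfolding block_def
    by (metis in_keys_iff less_le of_int_0_less_iff zero_less_divide_1_iff zero_less_mult_iff)
  then show ?thesis
    unfolding cross_number_def wsum_def using p by (intro sum_pos) auto
qed

text \<open>A cross number other than 1 would be an integer \<open>k \<ge> d + 1\<close>. Grouping
  the support by the part of the order prime to a fixed \<open>r\<close> produces at most
  \<open>d - 1\<close> chains, each contributing less than 1.\<close>

lemma cross_number_atom:
  assumes cong: "pairwise_congruent" and d: "length_congruent d" "d > 0" "n < d * d"
    and c: "block_atom c"
  shows "cross_number c = 1"
proof (rule ccontr)
  assume ne: "cross_number c \<noteq> 1"
  obtain k where k: "cross_number c = of_int k" "d dvd k - 1"
    using cross_number_atom_integer[OF cong d(1) c] by blast
  have "cross_number c > 0" using c by (intro cross_number_pos) (auto simp: block_atom_def)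
  then have k1: "k > 1" using k(1) ne by auto
  have sum_less: "(\<Sum>p\<in>F. Poly_Mapping.lookup c p / ordr p :: real) < 1"
    if "F \<subseteq> Poly_Mapping.keys c" "\<And>p p'. p \<in> F \<Longrightarrow> p' \<in> F \<Longrightarrow> ordr p dvd ordr p' \<or> ordr p' dvd ordr p" for F
    using cross_number_chain[OF cong c that] ne by fastforce
  have cn: "cross_number c = (\<Sum>p\<in>Poly_Mapping.keys c. Poly_Mapping.lookup c p / ordr p)"
    by (simp add: cross_number_def wsum_def)
  show False
  \<comment> \<open>For \<open>n = 1\<close> no prime divisor can be chosen, but all orders are 1
    and the support is a single chain.\<close>
  proof (cases "n = 1")
    case True
    have "ordr p dvd ordr p'" for p p' using ordr_dvd[of p] True by (simp add: dvd_trans[of _ 1])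
    then have "cross_number c < 1" unfolding cn by (intro sum_less) auto
    then show False using k k1 by simp
  next
    case False
    then obtain r where r: "r dvd n" "Factorial_Ring.prime r"
      using prime_divisor_exists[of n] n_pos by auto
    then have nu: "\<not> is_unit r" by auto
    \<comment> \<open>Orders with the same \<open>e\<close> differ only by a power of
      \<open>r\<close>, so each fibre of \<open>e\<close> is a divisibility chain.\<close>
    define e where "e = (\<lambda>p. ordr p div r ^ multiplicity r (ordr p))"
    have e: "ordr p = e p * r ^ multiplicity r (ordr p)" for p
      unfolding e_def by (simp add: multiplicity_dvd)
    have e_pos: "e p > 0" for p
      using ordr_pos[of p] e[of p] prime_gt_0_int[OF r(2)]
      by (metis zero_less_mult_pos2 zero_less_power)
    have e_dvd: "e p dvd n" for p using ordr_dvd[of p] e[of p] by (metis dvd_mult_left)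
    have e_r: "\<not> r dvd e p" for p
      unfolding e_def using multiplicity_decompose[OF _ nu, of "ordr p"] ordr_pos[of p] by auto
    define E where "E = e ` Poly_Mapping.keys c"
    have "int (card E) \<le> d - 1"
      using card_divisors_prime_to[of n d r E] n_pos d r e_pos e_dvd e_r by (auto simp: E_def)
    have "cross_number c = (\<Sum>x\<in>E. \<Sum>p\<in>{p \<in> Poly_Mapping.keys c. e p = x}. Poly_Mapping.lookup c p / ordr p)"
      unfolding cn E_def by (rule sum.image_gen) simp
    also have "\<dots> \<le> (\<Sum>x\<in>E. 1)"
    proof (rule sum_mono, rule less_imp_le[OF sum_less])
      fix x p p' assume "p \<in> {p \<in> Poly_Mapping.keys c. e p = x}" "p' \<in> {p \<in> Poly_Mapping.keys c. e p = x}"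
      then have ee: "e p = e p'" by simp
      show "ordr p dvd ordr p' \<or> ordr p' dvd ordr p"
        using e[of p] e[of p'] unfolding ee by (metis le_cases le_imp_power_dvd mult_dvd_mono dvd_refl)
    qed auto
    also have "\<dots> = card E" by simp
    finally have "k \<le> d - 1" using \<open>int (card E) \<le> d - 1\<close> k(1) by simp
    moreover have "d \<le> k - 1" using k k1 by (intro zdvd_imp_le) auto
    ultimately show False by simp
  qed
qed

lemma block_atoms_sum_list: "\<forall>a\<in>set us. block_atom a \<Longrightarrow> block (sum_list us)"
  by (induction us) (auto simp: block_atom_def block_add)

text \<open>Under pairwise congruence the cross number of a block counts the atoms in each of its
  factorizations; a failing pair supplies the determinant formula, with its common order as the
  divisor \<open>N\<close>.\<close>

theorem common_order_or_half_factorial: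
  assumes d: "length_congruent d" "d > 0" "n < d * d"
  shows "(\<exists>N c1 c2 q. N dvd n \<and> c1 > 0 \<and> c2 > 0 \<and> q > 0 \<and> d dvd q \<and> N = c1 + c2 + q * c1 * c2) \<or>
    (\<forall>us vs. (\<forall>a\<in>set us \<union> set vs. block_atom a) \<longrightarrow> sum_list us = sum_list vs \<longrightarrow> length us = length vs)"
proof (cases pairwise_congruent)
  case True
  have "cross_number (sum_list us) = length us" if "\<forall>a\<in>set us. block_atom a" for us
    using that
  proof (induction us)
    case (Cons a us)
    then show ?case using cross_number_atom[OF True d, of a] by (simp add: cross_number_add)
  qed (simp add: cross_number_def)
  then show ?thesis by (metis UnCI of_nat_eq_iff)
next
  case False
  then show ?thesis
    using incongruent_pair[OF _ _ d] common_order_dvd unfolding pairwise_congruent_def by metis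
qed

lemma block_sum_of_atoms:
  assumes "block c" shows "\<exists>us. (\<forall>a\<in>set us. block_atom a) \<and> sum_list us = c"
  using assms
proof (induction "nat (wsum (\<lambda>_. 1) c)" arbitrary: c rule: less_induct)
  case less
  have deg: "wsum (\<lambda>_. 1 :: int) b > 0" if "block b" and b0: "b \<noteq> 0" for b
  proof -
    obtain p where "p \<in> Poly_Mapping.keys b" using b0 by fastforce
    moreover have "Poly_Mapping.lookup b q > 0" if "q \<in> Poly_Mapping.keys b" for q
      using that \<open>block b\<close> unfolding block_def by (metis in_keys_iff less_le)
    ultimately show ?thesis unfolding wsum_def by (intro sum_pos) auto
  qed
  show ?case
  proof (cases "c = 0 \<or> block_atom c")
    case True
    then show ?thesis
    proof
      assume "c = 0" then show ?thesis by (intro exI[of _ "[]"]) simp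
    next
      assume "block_atom c" then show ?thesis by (intro exI[of _ "[c]"]) simp
    qed
  next
    case False
    then obtain u v where uv: "block u" "block v" "c = u + v" "u \<noteq> 0" "v \<noteq> 0"
      using less.prems unfolding block_atom_def by blast
    have "nat (wsum (\<lambda>_. 1) u) < nat (wsum (\<lambda>_. 1) c)" "nat (wsum (\<lambda>_. 1) v) < nat (wsum (\<lambda>_. 1) c)"
      using deg[OF uv(1,4)] deg[OF uv(2,5)] by (simp_all add: uv(3) wsum_add)
    then obtain us vs where "\<forall>a\<in>set us. block_atom a" "sum_list us = u"
      "\<forall>a\<in>set vs. block_atom a" "sum_list vs = v"
      using less.hyps uv by metis
    then show ?thesis using uv by (intro exI[of _ "us @ vs"]) auto
  qed
qed

end

section \<open>Divisor homomorphisms onto the blocks\<close>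

lemma carrier_free_Abelian_monoid [simp]:
  "c \<in> carrier (free_Abelian_monoid P) \<longleftrightarrow>
     Poly_Mapping.keys c \<subseteq> P \<and> (\<forall>p. 0 \<le> Poly_Mapping.lookup c p)"
  by (simp add: free_Abelian_monoid_def)

lemma mult_free_Abelian_monoid [simp]: "x \<otimes>\<^bsub>free_Abelian_monoid P\<^esub> y = x + y"
  by (simp add: free_Abelian_monoid_def)

lemma one_free_Abelian_monoid [simp]: "\<one>\<^bsub>free_Abelian_monoid P\<^esub> = 0"
  by (simp add: free_Abelian_monoid_def)

text \<open>The map \<open>\<phi>\<close> need not be injective: it identifies associated elements,
  which is harmless since lengths are defined up to units.\<close>

locale block_presentation = zero_sum_monoid P cl n + comm_monoid_cancel H
  for P :: "'p set" and cl n and H (structure) +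
  fixes \<phi>
  assumes divisor_hom: "divisor_hom H P \<phi>"
    and image: "\<phi> ` carrier H = Collect block"
begin

lemma phi_mult: "a \<in> carrier H \<Longrightarrow> b \<in> carrier H \<Longrightarrow> \<phi> (a \<otimes> b) = \<phi> a + \<phi> b"
  using divisor_hom unfolding divisor_hom_def hom_def by simp

lemma phi_one: "\<phi> \<one> = 0"
  using divisor_hom unfolding divisor_hom_def by simp

lemma phi_block: "a \<in> carrier H \<Longrightarrow> block (\<phi> a)"
  using image by auto

lemma block_imp_phi: "block c \<Longrightarrow> \<exists>a\<in>carrier H. \<phi> a = c"
  using image by (metis imageE mem_Collect_eq)

lemma phi_nonneg: "a \<in> carrier H \<Longrightarrow> 0 \<le> Poly_Mapping.lookup (\<phi> a) p"
  using phi_block unfolding block_def by blast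

text \<open>A difference of two blocks with nonnegative coefficients is again a block, so
  divisibility is comparison of coefficients.\<close>

lemma divides_iff:
  assumes "a \<in> carrier H" "b \<in> carrier H"
  shows "a divides b \<longleftrightarrow> (\<forall>p. Poly_Mapping.lookup (\<phi> a) p \<le> Poly_Mapping.lookup (\<phi> b) p)"
proof
  assume "a divides b"
  then obtain c where c: "c \<in> carrier H" "b = a \<otimes> c" by (auto simp: factor_def)
  then show "\<forall>p. Poly_Mapping.lookup (\<phi> a) p \<le> Poly_Mapping.lookup (\<phi> b) p"
    using assms phi_nonneg by (simp add: phi_mult lookup_add)
next
  assume *: "\<forall>p. Poly_Mapping.lookup (\<phi> a) p \<le> Poly_Mapping.lookup (\<phi> b) p"
  then have "block (\<phi> b - \<phi> a)" using assms phi_block by (intro block_diff) auto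
  then have "\<phi> a divides\<^bsub>free_Abelian_monoid P\<^esub> \<phi> b"
    unfolding factor_def by (intro bexI[of _ "\<phi> b - \<phi> a"]) (auto simp: block_def)
  then show "a divides b" using divisor_hom assms unfolding divisor_hom_def by blast
qed

lemma associated_iff:
  assumes "a \<in> carrier H" "b \<in> carrier H"
  shows "a \<sim> b \<longleftrightarrow> \<phi> a = \<phi> b"
  using divides_iff[OF assms] divides_iff[OF assms(2,1)]
  by (auto simp: associated_def intro!: poly_mapping_eqI order_antisym)

lemma Units_iff:
  assumes a: "a \<in> carrier H"
  shows "a \<in> Units H \<longleftrightarrow> \<phi> a = 0"
proof
  assume "a \<in> Units H"
  then have "\<phi> a = \<phi> \<one>"
    using a divides_iff[of a \<one>] phi_nonneg[OF a] unit_divides[of a \<one>]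
    by (intro poly_mapping_eqI) (simp add: phi_one order_antisym)
  then show "\<phi> a = 0" by (simp add: phi_one)
next
  assume "\<phi> a = 0"
  then have "\<one> \<sim> a" using a by (simp add: associated_iff phi_one)
  then show "a \<in> Units H" using a Units_cong by blast
qed

lemma irreducible_iff:
  assumes a: "a \<in> carrier H"
  shows "Divisibility.irreducible H a \<longleftrightarrow> block_atom (\<phi> a)"
proof
  assume irr: "Divisibility.irreducible H a"
  show "block_atom (\<phi> a)"
    unfolding block_atom_def
  proof (intro conjI allI impI)
    show "block (\<phi> a)" using a by (rule phi_block)
    show "\<phi> a \<noteq> 0" using irr Units_iff[OF a] by (simp add: Divisibility.irreducible_def)
    fix u v assume uv: "block u" "block v" "\<phi> a = u + v"
    then obtain b c where bc: "b \<in> carrier H" "c \<in> carrier H" "u = \<phi> b" "v = \<phi> c" using block_imp_phi by metis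
    have ba: "b divides a"
      using bc uv phi_nonneg by (simp add: divides_iff a lookup_add)
    show "u = 0 \<or> v = 0"
    proof (cases "a divides b")
      case True
      then have "\<phi> a = \<phi> b" using ba bc a associated_iff by (auto simp: associated_def)
      then show ?thesis using uv bc by simp
    next
      case False
      then have "b \<in> Units H" using irr ba bc by (simp add: Divisibility.irreducible_def properfactor_def)
      then show ?thesis using bc Units_iff by simp
    qed
  qed
next
  assume at: "block_atom (\<phi> a)"
  show "Divisibility.irreducible H a"
    unfolding Divisibility.irreducible_def
  proof (intro conjI ballI impI)
    show "a \<notin> Units H" using at Units_iff[OF a] by (simp add: block_atom_def)
    fix b assume b: "b \<in> carrier H" "properfactor H b a"
    then obtain c where c: "c \<in> carrier H" "a = b \<otimes> c" by (auto simp: properfactor_def factor_def)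
    then have "\<phi> b = 0 \<or> \<phi> c = 0"
      using at b phi_block phi_mult unfolding block_atom_def by metis
    moreover have "\<phi> c \<noteq> 0"
    proof
      assume "\<phi> c = 0"
      then have "\<phi> a = \<phi> b" using c b phi_mult by simp
      then show False using b a divides_iff[of a b] by (simp add: properfactor_def)
    qed
    ultimately show "b \<in> Units H" using b Units_iff by blast
  qed
qed

lemma phi_foldr: "set us \<subseteq> carrier H \<Longrightarrow> \<phi> (foldr (\<otimes>) us \<one>) = sum_list (map \<phi> us)"
  by (induction us) (auto simp: phi_one phi_mult)

text \<open>Atoms lift to irreducible elements through arbitrary preimages. The product of the
  preimages is only associated to \<open>a\<close>, exactly what \<open>wfactors\<close> asks
  for.\<close>

lemma lengths_eq:
  assumes a: "a \<in> carrier H"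
  shows "lengths H a = {length cs | cs. (\<forall>c\<in>set cs. block_atom c) \<and> sum_list cs = \<phi> a}"
proof (intro equalityI subsetI)
  fix l assume "l \<in> lengths H a"
  then obtain us where us: "l = length us" "set us \<subseteq> carrier H" "wfactors H us a"
    by (auto simp: lengths_def)
  have "\<forall>c\<in>set (map \<phi> us). block_atom c" using us irreducible_iff by (auto simp: wfactors_def)
  moreover have "sum_list (map \<phi> us) = \<phi> a"
    using us a associated_iff[of "foldr (\<otimes>) us \<one>" a] by (simp add: wfactors_def phi_foldr)
  ultimately show "l \<in> {length cs | cs. (\<forall>c\<in>set cs. block_atom c) \<and> sum_list cs = \<phi> a}"
    using us(1) by (intro CollectI exI[of _ "map \<phi> us"]) simp
next
  fix l assume "l \<in> {length cs | cs. (\<forall>c\<in>set cs. block_atom c) \<and> sum_list cs = \<phi> a}"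
  then obtain cs where cs: "l = length cs" "\<forall>c\<in>set cs. block_atom c" "sum_list cs = \<phi> a" by blast
  define us where "us = map (inv_into (carrier H) \<phi>) cs"
  have inv: "inv_into (carrier H) \<phi> c \<in> carrier H" "\<phi> (inv_into (carrier H) \<phi> c) = c" if "c \<in> set cs" for c
    using cs that image by (auto simp: block_atom_def intro!: inv_into_into f_inv_into_f)
  have us: "set us \<subseteq> carrier H" using inv by (auto simp: us_def)
  have map: "map \<phi> us = cs" using inv by (simp add: us_def map_idI)
  have "\<forall>u\<in>set us. Divisibility.irreducible H u"
    using us cs map irreducible_iff by (metis imageI list.set_map subsetD)
  moreover have "foldr (\<otimes>) us \<one> \<sim> a"
    using us cs a by (subst associated_iff) (auto simp: phi_foldr map)
  ultimately have "wfactors H us a" by (simp add: wfactors_def)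
  moreover have "l = length us" using cs by (simp add: us_def)
  ultimately show "l \<in> lengths H a" using us unfolding lengths_def by blast
qed

lemma length_mem_lengths:
  assumes "a \<in> carrier H" "\<forall>c\<in>set cs. block_atom c" "sum_list cs = \<phi> a"
  shows "length cs \<in> lengths H a"
  unfolding lengths_eq[OF assms(1)] using assms(2,3) by blast

lemma congruence_half_factorial_iff:
  "congruence_half_factorial d H \<longleftrightarrow> length_congruent (int d)"
proof
  assume *: "congruence_half_factorial d H"
  show "length_congruent (int d)"
    unfolding length_congruent_def
  proof (intro allI impI)
    fix us vs assume uv: "\<forall>a\<in>set us \<union> set vs. block_atom a" "sum_list us = sum_list vs"
    then have "block (sum_list us)" by (intro block_atoms_sum_list) auto
    then obtain a where a: "a \<in> carrier H" "\<phi> a = sum_list us" using block_imp_phi by blast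
    have "length us \<in> lengths H a"
      by (rule length_mem_lengths[OF a(1)]) (use a uv in \<open>blast, metis\<close>)
    moreover have "length vs \<in> lengths H a"
      by (rule length_mem_lengths[OF a(1)]) (use a uv in \<open>blast, metis\<close>)
    ultimately have "[length us = length vs] (mod d)" using * a unfolding congruence_half_factorial_def by blast
    then have "[int (length us) = int (length vs)] (mod int d)" by (simp add: cong_int_iff)
    then show "int d dvd int (length us) - int (length vs)" by (simp add: cong_iff_dvd_diff)
  qed
next
  assume *: "length_congruent (int d)"
  show "congruence_half_factorial d H"
    unfolding congruence_half_factorial_def
  proof (intro ballI)
    fix a l l' assume a: "a \<in> carrier H" and l: "l \<in> lengths H a" "l' \<in> lengths H a"
    from l obtain us where us: "\<forall>c\<in>set us. block_atom c" "sum_list us = \<phi> a" "l = length us"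
      unfolding lengths_eq[OF a] by blast
    from l obtain vs where vs: "\<forall>c\<in>set vs. block_atom c" "sum_list vs = \<phi> a" "l' = length vs"
      unfolding lengths_eq[OF a] by blast
    have "\<forall>c\<in>set us \<union> set vs. block_atom c" "sum_list us = sum_list vs"
      using us vs by auto
    then have "int d dvd int l - int l'" unfolding us(3) vs(3) using * unfolding length_congruent_def by blast
    then have "[int l = int l'] (mod int d)" by (simp add: cong_iff_dvd_diff)
    then show "[l = l'] (mod d)" by (simp add: cong_int_iff)
  qed
qed

text \<open>Equality of lengths bounds the cardinality by 1; that the set of lengths is inhabited
  comes from \<open>block_sum_of_atoms\<close>.\<close>

lemma half_factorial_iff:
  "half_factorial H \<longleftrightarrow> (\<forall>us vs. (\<forall>a\<in>set us \<union> set vs. block_atom a) \<longrightarrow>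
     sum_list us = sum_list vs \<longrightarrow> length us = length vs)"
proof
  assume *: "half_factorial H"
  show "\<forall>us vs. (\<forall>a\<in>set us \<union> set vs. block_atom a) \<longrightarrow> sum_list us = sum_list vs \<longrightarrow> length us = length vs"
  proof (intro allI impI)
    fix us vs assume uv: "\<forall>a\<in>set us \<union> set vs. block_atom a" "sum_list us = sum_list vs"
    then have "block (sum_list us)" by (intro block_atoms_sum_list) auto
    then obtain a where a: "a \<in> carrier H" "\<phi> a = sum_list us" using block_imp_phi by blast
    have "length us \<in> lengths H a"
      by (rule length_mem_lengths[OF a(1)]) (use a uv in \<open>blast, metis\<close>)
    moreover have "length vs \<in> lengths H a"
      by (rule length_mem_lengths[OF a(1)]) (use a uv in \<open>blast, metis\<close>)
    moreover have "card (lengths H a) = 1" using * a by (simp add: half_factorial_def)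
    ultimately show "length us = length vs" by (auto simp: card_1_singleton_iff)
  qed
next
  assume *: "\<forall>us vs. (\<forall>a\<in>set us \<union> set vs. block_atom a) \<longrightarrow> sum_list us = sum_list vs \<longrightarrow> length us = length vs"
  show "half_factorial H"
    unfolding half_factorial_def
  proof
    fix a assume a: "a \<in> carrier H"
    obtain us where us: "\<forall>c\<in>set us. block_atom c" "sum_list us = \<phi> a"
      using block_sum_of_atoms[OF phi_block[OF a]] by blast
    have "length cs = length us" if "\<forall>c\<in>set cs. block_atom c" "sum_list cs = \<phi> a" for cs
      using * us that by (metis UnE)
    then have "lengths H a = {length us}" unfolding lengths_eq[OF a] using us by blast
    then show "card (lengths H a) = 1" by simp
  qed
qed

end

section \<open>Class groups\<close>

lemma divisor_hom_carrier:
  assumes "divisor_hom H P \<phi>" "a \<in> carrier H"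
  shows "\<phi> a \<in> carrier (free_Abelian_monoid P)"
proof -
  have "\<phi> \<in> hom H (free_Abelian_monoid P)" using assms(1) unfolding divisor_hom_def by blast
  then show ?thesis using assms(2) by (rule hom_in_carrier)
qed

lemma (in comm_monoid_cancel) class_group_subgroup:
  assumes "divisor_hom G P \<phi>"
  shows "subgroup {\<phi> a - \<phi> b | a b. a \<in> carrier G \<and> b \<in> carrier G} (free_Abelian_group P)"
    (is "subgroup ?K _")
proof (rule group.subgroupI[OF group_free_Abelian_group])
  have mult: "\<phi> (a \<otimes> b) = \<phi> a + \<phi> b" if "a \<in> carrier G" "b \<in> carrier G" for a b
    using assms that unfolding divisor_hom_def hom_def by simp
  have keys: "Poly_Mapping.keys (\<phi> a) \<subseteq> P" if "a \<in> carrier G" for a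
    using divisor_hom_carrier[OF assms that] by simp
  have keysK: "Poly_Mapping.keys x \<subseteq> P" if "x \<in> ?K" for x
  proof -
    from that obtain a b where "a \<in> carrier G" "b \<in> carrier G" "x = \<phi> a - \<phi> b" by blast
    then show ?thesis using keys keys_diff[of "\<phi> a" "\<phi> b"] by blast
  qed
  then show "?K \<subseteq> carrier (free_Abelian_group P)"
    unfolding subset_iff[of ?K] carrier_free_Abelian_group_iff by blast
  show "?K \<noteq> {}" using one_closed by blast
  fix x assume x: "x \<in> ?K"
  then obtain a b where ab: "a \<in> carrier G" "b \<in> carrier G" "x = \<phi> a - \<phi> b" by blast
  then have "inv\<^bsub>free_Abelian_group P\<^esub> x = \<phi> b - \<phi> a" using keysK[OF x] by simp
  then show "inv\<^bsub>free_Abelian_group P\<^esub> x \<in> ?K" using ab by blast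
  fix y assume "y \<in> ?K"
  then obtain c d where cd: "c \<in> carrier G" "d \<in> carrier G" "y = \<phi> c - \<phi> d" by blast
  have "x + y = \<phi> (a \<otimes> c) - \<phi> (b \<otimes> d)" using ab cd by (simp add: mult)
  moreover have "a \<otimes> c \<in> carrier G" "b \<otimes> d \<in> carrier G" using ab cd by auto
  ultimately show "x \<otimes>\<^bsub>free_Abelian_group P\<^esub> y \<in> ?K" unfolding mult_free_Abelian_group by blast
qed

text \<open>Fix a generator \<open>g\<close> of the class group and let \<open>cl p\<close> be the
  discrete logarithm of the class of \<open>p\<close>. A vector then has trivial class iff
  \<open>n\<close> divides its weighted sum, and the nonnegative vectors of trivial class are the
  image of \<open>\<phi>\<close>.\<close>

lemma (in comm_monoid_cancel) exists_block_presentation: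
  fixes \<phi> :: "'a \<Rightarrow> 'p \<Rightarrow>\<^sub>0 int"
  assumes dh: "divisor_hom G P \<phi>" and cyc: "cyclic_group (class_group G P \<phi>)"
    and ord: "order (class_group G P \<phi>) = n" "n > 0"
  shows "\<exists>cl. block_presentation P cl (int n) G \<phi>"
proof -
  define F where "F = free_Abelian_group P"
  define K where "K = {\<phi> a - \<phi> b | a b. a \<in> carrier G \<and> b \<in> carrier G}"
  have sub: "subgroup K F" unfolding K_def F_def by (rule class_group_subgroup[OF dh])
  interpret F: comm_group F unfolding F_def by (rule abelian_free_Abelian_group)
  interpret K: normal K F using F.subgroup_imp_normal[OF sub] .
  interpret C: group "F Mod K" by (rule K.factorgroup_is_group)
  have CG: "class_group G P \<phi> = F Mod K" by (simp add: class_group_def F_def K_def)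
  obtain g where g: "g \<in> carrier (F Mod K)" "subgroup_generated (F Mod K) {g} = F Mod K"
    using cyc unfolding CG cyclic_group_def by blast
  have og: "group.ord (F Mod K) g = n" using C.cyclic_order_is_ord[OF g(1)] g(2) ord CG by simp
  have "carrier (F Mod K) = range (\<lambda>i::int. g [^]\<^bsub>F Mod K\<^esub> i)"
    using C.carrier_subgroup_generated_by_singleton[OF g(1)] g(2) by simp
  moreover have "K #>\<^bsub>F\<^esub> frag_of p \<in> carrier (F Mod K)" if "p \<in> P" for p
    using that by (auto simp: FactGroup_def F_def intro!: F.rcosetsI[unfolded F_def] K.subset[unfolded F_def])
  \<comment> \<open>The implication makes the choice function total; outside \<open>P\<close> its
    values are arbitrary.\<close>
  ultimately have "\<exists>i::int. p \<in> P \<longrightarrow> K #>\<^bsub>F\<^esub> frag_of p = g [^]\<^bsub>F Mod K\<^esub> i" for p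
    by (metis (no_types, lifting) rangeE)
  then obtain cl where cl: "p \<in> P \<Longrightarrow> K #>\<^bsub>F\<^esub> frag_of p = g [^]\<^bsub>F Mod K\<^esub> (cl p :: int)" for p
    by metis
  interpret h: group_hom F "F Mod K" "\<lambda>c. K #>\<^bsub>F\<^esub> c"
    by unfold_locales (rule K.r_coset_hom_Mod)
  have coset: "K #>\<^bsub>F\<^esub> c = g [^]\<^bsub>F Mod K\<^esub> wsum cl c" if "Poly_Mapping.keys c \<subseteq> P" for c
  proof (rule free_Abelian_group_induct[OF that, where P = "\<lambda>c. K #>\<^bsub>F\<^esub> c = g [^]\<^bsub>F Mod K\<^esub> wsum cl c"])
    show "K #>\<^bsub>F\<^esub> 0 = g [^]\<^bsub>F Mod K\<^esub> wsum cl 0" using h.hom_one by (simp add: F_def)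
  next
    fix x y assume xy: "Poly_Mapping.keys x \<subseteq> P" "Poly_Mapping.keys y \<subseteq> P"
      and eq: "K #>\<^bsub>F\<^esub> x = g [^]\<^bsub>F Mod K\<^esub> wsum cl x" "K #>\<^bsub>F\<^esub> y = g [^]\<^bsub>F Mod K\<^esub> wsum cl y"
    have F: "x \<in> carrier F" "y \<in> carrier F" using xy by (auto simp: F_def)
    have "x - y = x \<otimes>\<^bsub>F\<^esub> inv\<^bsub>F\<^esub> y" using xy by (simp add: F_def)
    then have "K #>\<^bsub>F\<^esub> (x - y) = (K #>\<^bsub>F\<^esub> x) \<otimes>\<^bsub>F Mod K\<^esub> inv\<^bsub>F Mod K\<^esub> (K #>\<^bsub>F\<^esub> y)"
      using h.hom_mult[OF F(1) F.inv_closed[OF F(2)]] h.hom_inv[OF F(2)] by metis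
    then show "K #>\<^bsub>F\<^esub> (x - y) = g [^]\<^bsub>F Mod K\<^esub> wsum cl (x - y)"
      unfolding eq wsum_diff C.int_pow_diff[OF g(1)] .
  qed (simp add: cl)
  have K_iff: "c \<in> K \<longleftrightarrow> int n dvd wsum cl c" if "Poly_Mapping.keys c \<subseteq> P" for c
  proof -
    have cF: "c \<in> carrier F" using that by (simp add: F_def)
    have "c \<in> K \<longleftrightarrow> K #>\<^bsub>F\<^esub> c = K"
      using F.coset_join1[OF _ cF sub] F.coset_join2[OF cF sub] K.subset by blast
    also have "\<dots> \<longleftrightarrow> g [^]\<^bsub>F Mod K\<^esub> wsum cl c = \<one>\<^bsub>F Mod K\<^esub>" using coset[OF that] by (simp add: FactGroup_def)
    also have "\<dots> \<longleftrightarrow> int n dvd wsum cl c" using C.int_pow_eq_id[OF g(1)] og by simp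
    finally show ?thesis .
  qed
  interpret zero_sum_monoid P cl "int n" using ord by unfold_locales simp
  have phi: "\<phi> a \<in> carrier (free_Abelian_monoid P)" if "a \<in> carrier G" for a
    by (rule divisor_hom_carrier[OF dh that])
  have phi_one: "\<phi> \<one> = 0" using dh unfolding divisor_hom_def by simp
  have "\<phi> ` carrier G = Collect block"
  proof (intro equalityI subsetI)
    fix c assume "c \<in> \<phi> ` carrier G"
    then obtain a where a: "a \<in> carrier G" "c = \<phi> a" by blast
    then have "c = \<phi> a - \<phi> \<one>" by (simp add: phi_one)
    then have "c \<in> K" using a unfolding K_def by blast
    then show "c \<in> Collect block" using phi[OF a(1)] a K_iff by (simp add: block_def)
  next
    fix c assume "c \<in> Collect block"
    then have c: "Poly_Mapping.keys c \<subseteq> P" "\<And>p. 0 \<le> Poly_Mapping.lookup c p" "c \<in> K"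
      using K_iff by (auto simp: block_def)
    then obtain a b where ab: "a \<in> carrier G" "b \<in> carrier G" "c = \<phi> a - \<phi> b" unfolding K_def by blast
    \<comment> \<open>Since \<open>\<phi>\<close> reflects divisibility, a nonnegative difference
      \<open>\<phi> a - \<phi> b\<close> is the image of the quotient of \<open>a\<close> by
      \<open>b\<close>.\<close>
    then have "\<phi> b divides\<^bsub>free_Abelian_monoid P\<^esub> \<phi> a"
      unfolding factor_def using c by (intro bexI[of _ c]) auto
    then have "b divides a" using dh ab unfolding divisor_hom_def by blast
    then obtain e where e: "e \<in> carrier G" "a = b \<otimes> e" by (auto simp: factor_def)
    then have "\<phi> a = \<phi> b + \<phi> e" using dh ab unfolding divisor_hom_def hom_def by simp
    then show "c \<in> \<phi> ` carrier G" using ab e by simp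
  qed
  then have "block_presentation P cl (int n) G \<phi>"
    using dh by unfold_locales auto
  then show ?thesis by (intro exI)
qed

lemma class_group_order_imp_J:
  fixes \<phi> :: "'a \<Rightarrow> 'p \<Rightarrow>\<^sub>0 int" and d n :: nat
  assumes "comm_monoid_cancel H" "divisor_hom H P \<phi>"
    and "cyclic_group (class_group H P \<phi>)" "order (class_group H P \<phi>) = n"
    and hf: "\<not> half_factorial H" "congruence_half_factorial d H"
    and d: "d > 0" "n > 0" "n < d * d"
  shows "d \<in> (\<Union>m\<in>{m. m dvd n}. J m)"
proof -
  obtain cl where "block_presentation P cl (int n) H \<phi>"
    using comm_monoid_cancel.exists_block_presentation assms by blast
  then interpret block_presentation P cl "int n" H \<phi> .
  have "length_congruent (int d)" using hf by (simp add: congruence_half_factorial_iff)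
  moreover have "int n < int d * int d" using d by (metis of_nat_less_iff of_nat_mult)
  ultimately obtain N c1 c2 q where *: "N dvd int n" "c1 > 0" "c2 > 0" "q > 0" "int d dvd q"
    "N = c1 + c2 + q * c1 * c2"
    using common_order_or_half_factorial[of "int d"] hf d unfolding half_factorial_iff by auto
  define m where "m = nat N"
  have N: "N > 0" using * by (simp add: add_pos_pos)
  then have mn: "m dvd n" using *(1) by (simp add: m_def nat_dvd_iff flip: int_dvd_int_iff)
  \<comment> \<open>Positivity of the product term places \<open>c1\<close> and \<open>c2\<close>
    below \<open>N\<close>, the range that \<open>J\<close> demands.\<close>
  have "0 < q * c1 * c2" using * by simp
  then have "c1 \<le> N" "c2 \<le> N" using * by linarith+
  then have c: "nat c1 \<in> {1..m}" "nat c2 \<in> {1..m}" using *(2,3) by (auto simp: m_def)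
  have "real m = of_int N" using N by (simp add: m_def)
  then have "(real m - real (nat c1) - real (nat c2)) / (real (nat c1) * real (nat c2)) = real (nat q)"
    using * by (simp add: field_simps)
  moreover have "int d dvd int (nat q)" using * by simp
  then have "d dvd nat q" by (simp only: int_dvd_int_iff)
  moreover have "nat q > 0" using * by simp
  ultimately have "d \<in> J m" unfolding J_def using c d by blast
  then show ?thesis using mn by blast
qed

lemma cyclic_integer_mod_group:
  assumes "n > 0" shows "cyclic_group (integer_mod_group n)"
  unfolding group.cyclic_group[OF group_integer_mod_group]
proof (rule bexI)
  \<comment> \<open>The generator is written \<open>1 mod int n\<close> to cover
    \<open>n = 1\<close>, where it is 0.\<close>
  have "i \<in> range (\<lambda>k::int. (1 mod int n) [^]\<^bsub>integer_mod_group n\<^esub> k)"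
    if "i \<in> carrier (integer_mod_group n)" for i
    using that assms
    by (intro range_eqI[of _ _ i])
      (simp add: int_pow_integer_mod_group carrier_integer_mod_group mod_mult_right_eq)
  moreover have "(1 mod int n) [^]\<^bsub>integer_mod_group n\<^esub> k \<in> carrier (integer_mod_group n)" for k :: int
    using assms by (simp add: int_pow_integer_mod_group carrier_integer_mod_group)
  ultimately show "carrier (integer_mod_group n) =
      range (\<lambda>k::int. (1 mod int n) [^]\<^bsub>integer_mod_group n\<^esub> k)"
    by blast
  show "1 mod int n \<in> carrier (integer_mod_group n)"
    using assms by (simp add: carrier_integer_mod_group)
qed

section \<open>Block monoids as abstract monoids\<close>

context zero_sum_monoid
begin

text \<open>The carrier type of the wanted monoid is prescribed, so the additive monoid of blocks is
  transported along an injection \<open>g\<close>, with \<open>\<phi>\<close> as its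
  inverse.\<close>

lemma exists_presentation:
  fixes g :: "('p \<Rightarrow>\<^sub>0 int) \<Rightarrow> 'a"
  assumes inj: "inj_on g (Collect block)"
  shows "\<exists>(H :: 'a monoid) \<phi>. block_presentation P cl n H \<phi>"
proof -
  define \<phi> where "\<phi> = inv_into (Collect block) g"
  have \<phi>: "\<phi> (g c) = c" if "block c" for c using that inj by (simp add: \<phi>_def)
  define H :: "'a monoid" where
    "H = \<lparr>carrier = g ` Collect block, monoid.mult = (\<lambda>x y. g (\<phi> x + \<phi> y)), one = g 0\<rparr>"
  have carr: "carrier H = g ` Collect block" by (simp add: H_def)
  have elim: "\<exists>c. block c \<and> x = g c" if "x \<in> carrier H" for x using that carr by auto
  have gc: "g c \<in> carrier H" if "block c" for c using that by (simp add: carr)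
  have mult: "g b \<otimes>\<^bsub>H\<^esub> g c = g (b + c)" if "block b" "block c" for b c
    using that by (simp add: H_def \<phi>)
  have one: "\<one>\<^bsub>H\<^esub> = g 0" by (simp add: H_def)
  have g_eq: "g b = g c \<longleftrightarrow> b = c" if "block b" "block c" for b c
    using that \<phi> by metis
  interpret comm_monoid_cancel H
  proof (rule comm_monoid_cancelI[OF comm_monoidI])
    fix x y z assume "x \<in> carrier H" "y \<in> carrier H" "z \<in> carrier H"
    then obtain a b c where *: "block a" "x = g a" "block b" "y = g b" "block c" "z = g c"
      using elim by metis
    show "x \<otimes>\<^bsub>H\<^esub> y \<otimes>\<^bsub>H\<^esub> z = x \<otimes>\<^bsub>H\<^esub> (y \<otimes>\<^bsub>H\<^esub> z)" using * by (simp add: mult block_add add.assoc)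
    assume "x \<otimes>\<^bsub>H\<^esub> z = y \<otimes>\<^bsub>H\<^esub> z"
    then show "x = y" using * by (simp add: mult block_add g_eq)
  next
    fix x y assume "x \<in> carrier H" "y \<in> carrier H"
    then obtain a b where *: "block a" "x = g a" "block b" "y = g b" using elim by metis
    show "x \<otimes>\<^bsub>H\<^esub> y \<in> carrier H" using * by (simp add: mult block_add gc)
    show "x \<otimes>\<^bsub>H\<^esub> y = y \<otimes>\<^bsub>H\<^esub> x" using * by (simp add: mult add.commute)
  next
    show "\<one>\<^bsub>H\<^esub> \<in> carrier H" by (simp add: one gc)
    fix x assume "x \<in> carrier H"
    then obtain a where "block a" "x = g a" using elim by metis
    then show "\<one>\<^bsub>H\<^esub> \<otimes>\<^bsub>H\<^esub> x = x" by (simp add: one mult)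
  qed
  have "divisor_hom H P \<phi>"
    unfolding divisor_hom_def
  proof (intro conjI ballI)
    show "\<phi> \<in> hom H (free_Abelian_monoid P)"
    proof (rule homI)
      fix x assume "x \<in> carrier H"
      then obtain a where "block a" "x = g a" using elim by metis
      then show "\<phi> x \<in> carrier (free_Abelian_monoid P)" by (simp add: \<phi> block_def)
    next
      fix x y assume "x \<in> carrier H" "y \<in> carrier H"
      then obtain a b where "block a" "x = g a" "block b" "y = g b" using elim by metis
      then show "\<phi> (x \<otimes>\<^bsub>H\<^esub> y) = \<phi> x \<otimes>\<^bsub>free_Abelian_monoid P\<^esub> \<phi> y"
        by (simp add: \<phi> mult block_add)
    qed
    show "\<phi> \<one>\<^bsub>H\<^esub> = \<one>\<^bsub>free_Abelian_monoid P\<^esub>" by (simp add: one \<phi>)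
    fix x y assume "x \<in> carrier H" "y \<in> carrier H"
    then obtain a b where ab: "block a" "x = g a" "block b" "y = g b" using elim by metis
    have "x divides\<^bsub>H\<^esub> y \<longleftrightarrow> (\<exists>c. block c \<and> b = a + c)"
    proof
      assume "x divides\<^bsub>H\<^esub> y"
      then obtain c where "block c" "y = x \<otimes>\<^bsub>H\<^esub> g c" using elim unfolding factor_def by metis
      then have "b = a + c" using ab by (simp add: mult g_eq block_add)
      then show "\<exists>c. block c \<and> b = a + c" using \<open>block c\<close> by blast
    next
      assume "\<exists>c. block c \<and> b = a + c"
      then show "x divides\<^bsub>H\<^esub> y" using ab mult gc unfolding factor_def by metis
    qed
    also have "\<dots> \<longleftrightarrow> a divides\<^bsub>free_Abelian_monoid P\<^esub> b"
    proof
      assume "\<exists>c. block c \<and> b = a + c"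
      then show "a divides\<^bsub>free_Abelian_monoid P\<^esub> b"
        unfolding factor_def by (auto simp: block_def)
    next
      assume "a divides\<^bsub>free_Abelian_monoid P\<^esub> b"
      then obtain c where c: "Poly_Mapping.keys c \<subseteq> P" "\<forall>p. 0 \<le> Poly_Mapping.lookup c p" "b = a + c"
        unfolding factor_def by auto
      then have "wsum cl c = wsum cl b - wsum cl a" by (simp add: wsum_add)
      then have "block c" using ab c by (simp add: block_def)
      then show "\<exists>c. block c \<and> b = a + c" using c by blast
    qed
    finally show "x divides\<^bsub>H\<^esub> y \<longleftrightarrow> \<phi> x divides\<^bsub>free_Abelian_monoid P\<^esub> \<phi> y"
      using ab by (simp add: \<phi>)
  qed
  moreover have "\<phi> ` carrier H = Collect block"
    using \<phi> by (force simp: carr image_iff)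
  ultimately have "block_presentation P cl n H \<phi>" by unfold_locales
  then show ?thesis by blast
qed

end

context block_presentation
begin

text \<open>Every zero-sum integer vector is a difference of two blocks: add a block large enough to
  make all coefficients nonnegative.\<close>

lemma class_group_eq_kernel:
  assumes fin: "finite P"
  shows "{\<phi> a - \<phi> b | a b. a \<in> carrier H \<and> b \<in> carrier H} =
    {c. Poly_Mapping.keys c \<subseteq> P \<and> n dvd wsum cl c}" (is "?K = ?R")
proof (intro equalityI subsetI)
  fix x assume "x \<in> ?K"
  then obtain a b where ab: "a \<in> carrier H" "b \<in> carrier H" "x = \<phi> a - \<phi> b" by blast
  then show "x \<in> ?R"
    using phi_block[OF ab(1)] phi_block[OF ab(2)] keys_diff[of "\<phi> a" "\<phi> b"]
    by (auto simp: block_def wsum_diff)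
next
  fix c assume "c \<in> ?R"
  then have c: "Poly_Mapping.keys c \<subseteq> P" "n dvd wsum cl c" by auto
  \<comment> \<open>Coefficients divisible by \<open>n\<close> make \<open>b\<close> zero-sum, and
    the absolute values make \<open>c + b\<close> nonnegative.\<close>
  define b where "b = (\<Sum>p\<in>P. Poly_Mapping.single p (n * \<bar>Poly_Mapping.lookup c p\<bar>))"
  have lb: "Poly_Mapping.lookup b p = (if p \<in> P then n * \<bar>Poly_Mapping.lookup c p\<bar> else 0)" for p
    using fin by (simp add: b_def lookup_sum lookup_single when_def sum.delta)
  then have "Poly_Mapping.keys b \<subseteq> P" by (metis in_keys_iff subsetI)
  moreover have "n dvd wsum cl b" by (auto simp: b_def wsum_sum mult.assoc intro!: dvd_sum)
  ultimately have b: "block b" using n_pos lb by (auto simp: block_def)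
  have "0 \<le> Poly_Mapping.lookup (c + b) p" for p
  proof (cases "p \<in> P")
    case True
    have "1 * \<bar>Poly_Mapping.lookup c p\<bar> \<le> n * \<bar>Poly_Mapping.lookup c p\<bar>"
      using n_pos by (intro mult_right_mono) auto
    then show ?thesis using lb True by (simp add: lookup_add)
  next
    case False
    then have "Poly_Mapping.lookup c p = 0" using c(1) by (metis in_keys_iff subsetD)
    then show ?thesis using lb False by (simp add: lookup_add)
  qed
  moreover have "Poly_Mapping.keys (c + b) \<subseteq> P"
    using c \<open>Poly_Mapping.keys b \<subseteq> P\<close> Poly_Mapping.keys_add[of c b] by blast
  ultimately have "block (c + b)" using c b by (simp add: block_def wsum_add)
  then obtain x y where "x \<in> carrier H" "y \<in> carrier H" "\<phi> x = c + b" "\<phi> y = b"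
    using b block_imp_phi by blast
  then show "c \<in> ?K" by (metis (mono_tags, lifting) add_diff_cancel_right' mem_Collect_eq)
qed

text \<open>The weighted sum modulo \<open>n\<close> is a homomorphism with the right kernel; a
  prime of class 1 makes it surjective.\<close>

lemma class_group_iso:
  assumes fin: "finite P" and p: "p \<in> P" "cl p = 1"
  shows "class_group H P \<phi> \<cong> integer_mod_group (nat n)"
proof -
  define F where "F = free_Abelian_group P"
  define h where "h = (\<lambda>c. wsum cl c mod n)"
  have int_n: "int (nat n) = n" using n_pos by simp
  have carr: "carrier (integer_mod_group (nat n)) = {0..<n}"
    using n_pos by (simp add: carrier_integer_mod_group)
  interpret h: group_hom F "integer_mod_group (nat n)" h
  proof (rule group_hom.intro)
    show "group_hom_axioms F (integer_mod_group (nat n)) h"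
    proof (rule group_hom_axioms.intro, rule homI)
      show "h x \<in> carrier (integer_mod_group (nat n))" for x
        using n_pos by (simp add: carr h_def)
      show "h (x \<otimes>\<^bsub>F\<^esub> y) = h x \<otimes>\<^bsub>integer_mod_group (nat n)\<^esub> h y" for x y
        using n_pos by (simp add: F_def h_def wsum_add mod_add_eq)
    qed
  qed (simp_all add: F_def)
  have "h ` carrier F = carrier (integer_mod_group (nat n))"
  proof (intro equalityI subsetI)
    fix i assume "i \<in> carrier (integer_mod_group (nat n))"
    then have "h (Poly_Mapping.single p i) = i" using p by (simp add: carr h_def)
    moreover have "Poly_Mapping.single p i \<in> carrier F" using p by (simp add: F_def)
    ultimately show "i \<in> h ` carrier F" by (metis imageI)
  qed (use h.hom_closed in auto)
  then have "F Mod kernel F (integer_mod_group (nat n)) h \<cong> integer_mod_group (nat n)"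
    by (rule h.FactGroup_iso)
  moreover have "kernel F (integer_mod_group (nat n)) h = {c. Poly_Mapping.keys c \<subseteq> P \<and> n dvd wsum cl c}"
    by (auto simp: kernel_def F_def h_def dvd_eq_mod_eq_0)
  ultimately show ?thesis
    unfolding class_group_def class_group_eq_kernel[OF fin] F_def by simp
qed

lemma class_group_cyclic_order:
  assumes "finite P" "p \<in> P" "cl p = 1"
  shows "cyclic_group (class_group H P \<phi>)" "order (class_group H P \<phi>) = nat n"
proof -
  have iso: "class_group H P \<phi> \<cong> integer_mod_group (nat n)" using assms by (rule class_group_iso)
  have "subgroup {\<phi> a - \<phi> b | a b. a \<in> carrier H \<and> b \<in> carrier H} (free_Abelian_group P)"
    unfolding class_group_eq_kernel[OF assms(1)]
    by (rule group.subgroupI[OF group_free_Abelian_group])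
      (auto simp: wsum_uminus wsum_add dest: subsetD[OF Poly_Mapping.keys_add] intro!: exI[of _ 0])
  then have "group (class_group H P \<phi>)"
    unfolding class_group_def
    by (intro normal.factorgroup_is_group comm_group.subgroup_imp_normal abelian_free_Abelian_group)
  then show "cyclic_group (class_group H P \<phi>)"
    using isomorphic_group_cyclicity[OF iso] cyclic_integer_mod_group[of "nat n"] n_pos by simp
  show "order (class_group H P \<phi>) = nat n"
    using iso_same_card[OF iso] n_pos by (simp add: order_def carrier_integer_mod_group)
qed

text \<open>Greatest common divisors in the free monoid are coordinatewise minima, so two blocks
  suffice to exhibit each prime.\<close>

lemma divisor_theoryI:
  assumes "\<And>p. p \<in> P \<Longrightarrow> \<exists>u v. block u \<and> block v \<and>
    (\<forall>j. min (Poly_Mapping.lookup u j) (Poly_Mapping.lookup v j) = (if j = p then 1 else 0))"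
  shows "divisor_theory H P \<phi>"
  unfolding divisor_theory_def
proof (intro conjI ballI)
  show "divisor_hom H P \<phi>" by (rule divisor_hom)
  fix p assume p: "p \<in> P"
  have free_divides: "x divides\<^bsub>free_Abelian_monoid P\<^esub> y \<longleftrightarrow>
      (\<forall>j. Poly_Mapping.lookup x j \<le> Poly_Mapping.lookup y j)"
    if "Poly_Mapping.keys x \<subseteq> P" "Poly_Mapping.keys y \<subseteq> P" for x y
  proof
    assume le: "\<forall>j. Poly_Mapping.lookup x j \<le> Poly_Mapping.lookup y j"
    have "y - x \<in> carrier (free_Abelian_monoid P)"
      using that le keys_diff[of y x] by (auto simp: lookup_minus)
    then show "x divides\<^bsub>free_Abelian_monoid P\<^esub> y"
      unfolding factor_def by (intro bexI[of _ "y - x"]) auto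
  qed (auto simp: factor_def lookup_add)
  obtain u v where uv: "block u" "block v"
    "\<And>j. min (Poly_Mapping.lookup u j) (Poly_Mapping.lookup v j) = (if j = p then 1 else 0)"
    using assms[OF p] by blast
  obtain a b where ab: "a \<in> carrier H" "b \<in> carrier H" "\<phi> a = u" "\<phi> b = v"
    using block_imp_phi[OF uv(1)] block_imp_phi[OF uv(2)] by blast
  have keys: "Poly_Mapping.keys u \<subseteq> P" "Poly_Mapping.keys v \<subseteq> P"
    "Poly_Mapping.keys (Poly_Mapping.single p (1::int)) \<subseteq> P"
    using uv(1,2) p by (auto simp: block_def)
  have single: "Poly_Mapping.lookup (Poly_Mapping.single p (1::int)) j =
      min (Poly_Mapping.lookup u j) (Poly_Mapping.lookup v j)" for j
    by (simp add: uv(3) lookup_single when_def)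
  have "is_gcd_of_set (free_Abelian_monoid P) (Poly_Mapping.single p 1) (\<phi> ` {a, b})"
    unfolding is_gcd_of_set_def
  proof (intro conjI ballI impI)
    fix x assume "x \<in> \<phi> ` {a, b}"
    then have "x = u \<or> x = v" using ab by auto
    moreover have "Poly_Mapping.single p 1 divides\<^bsub>free_Abelian_monoid P\<^esub> u"
      unfolding free_divides[OF keys(3,1)] single by simp
    moreover have "Poly_Mapping.single p 1 divides\<^bsub>free_Abelian_monoid P\<^esub> v"
      unfolding free_divides[OF keys(3,2)] single by simp
    ultimately show "Poly_Mapping.single p 1 divides\<^bsub>free_Abelian_monoid P\<^esub> x" by blast
  next
    fix y assume y: "y \<in> carrier (free_Abelian_monoid P)"
      "\<forall>x\<in>\<phi> ` {a, b}. y divides\<^bsub>free_Abelian_monoid P\<^esub> x"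
    then have "y divides\<^bsub>free_Abelian_monoid P\<^esub> u" "y divides\<^bsub>free_Abelian_monoid P\<^esub> v"
      using ab by auto
    moreover have y_keys: "Poly_Mapping.keys y \<subseteq> P" using y(1) by simp
    ultimately show "y divides\<^bsub>free_Abelian_monoid P\<^esub> Poly_Mapping.single p 1"
      unfolding free_divides[OF y_keys keys(3)] free_divides[OF y_keys keys(1)]
        free_divides[OF y_keys keys(2)] single by simp
  qed
  then show "\<exists>A\<subseteq>carrier H. finite A \<and> A \<noteq> {} \<and>
      is_gcd_of_set (free_Abelian_monoid P) (Poly_Mapping.single p 1) (\<phi> ` A)"
    using ab(1,2) by (intro exI[of _ "{a, b}"] conjI) simp_all
qed

end

section \<open>A realization with three primes\<close>

locale three_primes =
  fixes p1 p2 p3 :: 'p and c1 c2 q r :: int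
  assumes distinct: "p1 \<noteq> p2" "p1 \<noteq> p3" "p2 \<noteq> p3"
    and pos: "c1 > 0" "c2 > 0" "q > 0" "r > 0"
begin

definition m :: int where "m = c1 + c2 + q * c1 * c2"

text \<open>By \<open>e * e' = 1 + q * m\<close>, the numbers \<open>e\<close> and \<open>e'\<close>
  are inverse to each other modulo \<open>m\<close>; exchanging \<open>c1\<close> and
  \<open>c2\<close> exchanges them.\<close>

definition e :: int where "e = 1 + q * c2"

definition e' :: int where "e' = 1 + q * c1"

definition cl :: "'p \<Rightarrow> int" where "cl p = (if p = p1 then e * r else 1)"

text \<open>Modulo \<open>m * r\<close> this is \<open>e'\<close> times \<open>cl\<close>. The two
  weights describe the two straight pieces of the boundary, which meet at
  \<open>(c1, r * c2)\<close>.\<close>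

definition cl' :: "'p \<Rightarrow> int" where "cl' p = (if p = p1 then r else e')"

lemma m_pos: "m > 0" and m_eq: "m = c1 * e + c2" "m = c2 * e' + c1" and e_mult: "e * e' = 1 + q * m"
  and e_pos: "e > 0" "e' > 0"
  using pos by (auto simp: m_def e_def e'_def algebra_simps add_pos_pos)

sublocale zero_sum_monoid "{p1, p2, p3}" cl "m * r"
  using m_pos pos by unfold_locales simp

definition vec :: "int \<Rightarrow> int \<Rightarrow> int \<Rightarrow> 'p \<Rightarrow>\<^sub>0 int" where
  "vec x y z = Poly_Mapping.single p1 x + Poly_Mapping.single p2 y + Poly_Mapping.single p3 z"

lemma lookup_vec:
  "Poly_Mapping.lookup (vec x y z) p1 = x" "Poly_Mapping.lookup (vec x y z) p2 = y"
  "Poly_Mapping.lookup (vec x y z) p3 = z" "p \<notin> {p1, p2, p3} \<Longrightarrow> Poly_Mapping.lookup (vec x y z) p = 0"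
  using distinct by (auto simp: vec_def lookup_add lookup_single when_def)

lemma wsum_vec: "wsum cl (vec x y z) = e * r * x + (y + z)" "wsum cl' (vec x y z) = r * x + e' * (y + z)"
  using distinct by (simp_all add: vec_def wsum_add cl_def cl'_def algebra_simps)

lemma keys_vec: "Poly_Mapping.keys (vec x y z) \<subseteq> {p1, p2, p3}"
  using lookup_vec(4) by (metis in_keys_iff subsetI)

lemma block_vec_iff: "block (vec x y z) \<longleftrightarrow> 0 \<le> x \<and> 0 \<le> y \<and> 0 \<le> z \<and> m * r dvd e * r * x + (y + z)"
proof -
  have "(\<forall>p. 0 \<le> Poly_Mapping.lookup (vec x y z) p) \<longleftrightarrow> 0 \<le> x \<and> 0 \<le> y \<and> 0 \<le> z"
    using lookup_vec by (metis empty_iff insert_iff order_refl)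
  then show ?thesis using keys_vec by (simp add: block_def wsum_vec)
qed

lemma vec_surj:
  assumes "Poly_Mapping.keys b \<subseteq> {p1, p2, p3}"
  shows "b = vec (Poly_Mapping.lookup b p1) (Poly_Mapping.lookup b p2) (Poly_Mapping.lookup b p3)" (is "b = ?v")
proof (rule poly_mapping_eqI)
  fix p
  show "Poly_Mapping.lookup b p = Poly_Mapping.lookup ?v p"
  proof (cases "p \<in> {p1, p2, p3}")
    case True
    then show ?thesis using lookup_vec(1-3) by auto
  next
    case False
    then have "Poly_Mapping.lookup b p = 0" using assms by (metis in_keys_iff subsetD)
    then show ?thesis using lookup_vec(4)[OF False] by simp
  qed
qed

lemma block_cases:
  assumes "block b"
  obtains x y z where "b = vec x y z" "0 \<le> x" "0 \<le> y" "0 \<le> z" "m * r dvd e * r * x + (y + z)"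
proof -
  have "b = vec (Poly_Mapping.lookup b p1) (Poly_Mapping.lookup b p2) (Poly_Mapping.lookup b p3)"
    using assms by (intro vec_surj) (simp add: block_def)
  then show thesis using assms that block_vec_iff by metis
qed

lemma vec_eq_0_iff: "vec x y z = 0 \<longleftrightarrow> x = 0 \<and> y = 0 \<and> z = 0"
proof
  assume *: "vec x y z = 0"
  show "x = 0 \<and> y = 0 \<and> z = 0"
    using lookup_vec(1-3)[of x y z] unfolding * by simp
qed (simp add: vec_def)

lemma weights_relation: "e' * wsum cl (vec x y z) = wsum cl' (vec x y z) + q * (m * r) * x"
proof -
  have "e' * wsum cl (vec x y z) = (e * e') * r * x + e' * (y + z)"
    by (simp add: wsum_vec algebra_simps)
  then show ?thesis by (simp add: e_mult wsum_vec algebra_simps)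
qed

text \<open>The identity \<open>e' = 1 + q * c1\<close> makes the two normalized weights agree
  modulo \<open>q\<close>, which allows both pieces of the boundary to be counted by one
  weight.\<close>

lemma weights:
  assumes "block b"
  shows "m * r dvd wsum cl b" "m * r dvd wsum cl' b"
    "q dvd wsum cl b div (m * r) - wsum cl' b div (m * r)"
    "b \<noteq> 0 \<Longrightarrow> wsum cl b > 0" "b \<noteq> 0 \<Longrightarrow> wsum cl' b > 0"
proof -
  from assms obtain x y z where b: "b = vec x y z" "0 \<le> x" "0 \<le> y" "0 \<le> z"
    by (rule block_cases)
  show 1: "m * r dvd wsum cl b" using assms by (simp add: block_def)
  have "wsum cl' b = e' * wsum cl b - (m * r) * (q * x)"
    using weights_relation[of x y z] by (simp add: b(1) algebra_simps)
  moreover obtain k where k: "wsum cl b = (m * r) * k" using 1 by blast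
  ultimately have k': "wsum cl' b = (m * r) * (e' * k - q * x)" by (simp add: algebra_simps)
  then show "m * r dvd wsum cl' b" by simp
  have "wsum cl b div (m * r) = k" "wsum cl' b div (m * r) = e' * k - q * x"
    unfolding k k' using n_pos by auto
  then have "wsum cl b div (m * r) - wsum cl' b div (m * r) = q * (x - c1 * k)"
    by (simp add: e'_def algebra_simps)
  then show "q dvd wsum cl b div (m * r) - wsum cl' b div (m * r)" by simp
  assume "b \<noteq> 0"
  then have "x > 0 \<or> y + z > 0" using b vec_eq_0_iff[of x y z] by auto
  moreover have "0 \<le> e * r * x" "0 \<le> r * x" "0 \<le> e' * (y + z)" using b pos e_pos by auto
  moreover have "x > 0 \<Longrightarrow> e * r * x > 0" "x > 0 \<Longrightarrow> r * x > 0" "y + z > 0 \<Longrightarrow> e' * (y + z) > 0"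
    using pos e_pos by auto
  ultimately show "wsum cl b > 0" "wsum cl' b > 0" using b by (auto simp: wsum_vec add_pos_nonneg add_nonneg_pos)
qed

text \<open>Both weights of a nonzero block are at least \<open>m * r\<close>, so a block attaining
  this value cannot be split.\<close>

lemma block_atom_weight:
  assumes b: "block b" "b \<noteq> 0" and w: "wsum cl b = m * r \<or> wsum cl' b = m * r"
  shows "block_atom b"
  unfolding block_atom_def
proof (intro conjI allI impI b)
  fix u v assume uv: "block u" "block v" "b = u + v"
  show "u = 0 \<or> v = 0"
  proof (rule ccontr)
    assume "\<not> (u = 0 \<or> v = 0)"
    then have ne: "u \<noteq> 0" "v \<noteq> 0" by auto
    have "m * r \<le> wsum cl u" "m * r \<le> wsum cl v" "m * r \<le> wsum cl' u" "m * r \<le> wsum cl' v"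
      using weights[OF uv(1)] weights[OF uv(2)] ne by (auto intro: zdvd_imp_le)
    then show False using w n_pos unfolding uv(3) wsum_add by linarith
  qed
qed

text \<open>Since \<open>p2\<close> and \<open>p3\<close> have the same class, only
  \<open>y + z\<close> matters: any zero-sum pair \<open>(x', s)\<close> below
  \<open>(x, y + z)\<close> is realized by distributing \<open>s\<close> over the two
  primes.\<close>

lemma block_atom_eq:
  assumes b: "block_atom (vec x y z)" "0 \<le> y" "0 \<le> z" and le: "0 \<le> x'" "x' \<le> x" "0 \<le> s" "s \<le> y + z"
    and zs: "m * r dvd e * r * x' + s" "x' > 0 \<or> s > 0"
  shows "x = x' \<and> y + z = s"
proof -
  define y' z' where "y' = min y s" and "z' = s - y'"
  have yz: "0 \<le> y'" "y' \<le> y" "0 \<le> z'" "z' \<le> z" "y' + z' = s"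
    using b le by (auto simp: y'_def z'_def)
  have "block (vec x' y' z')" using yz le zs by (simp add: block_vec_iff)
  moreover have "vec x' y' z' \<noteq> 0" using zs(2) yz by (auto simp: vec_eq_0_iff)
  moreover have "Poly_Mapping.lookup (vec x' y' z') p \<le> Poly_Mapping.lookup (vec x y z) p" for p
    using lookup_vec yz le by (metis empty_iff insert_iff order_refl)
  ultimately have "vec x' y' z' = vec x y z" by (rule block_atom_minimal[OF b(1)])
  then show ?thesis using lookup_vec(1-3) yz by metis
qed

text \<open>Compare the atom with the ray through the bend \<open>(c1, r * c2)\<close>. On either
  side some vector of weight exactly \<open>m * r\<close> lies below the atom and must equal
  it.\<close>

lemma weight_block_atom:
  assumes atom: "block_atom b"
  shows "wsum cl b = m * r \<or> wsum cl' b = m * r"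
proof -
  have b: "block b" "b \<noteq> 0" using atom by (auto simp: block_atom_def)
  obtain x y z where v: "b = vec x y z" "0 \<le> x" "0 \<le> y" "0 \<le> z" "m * r dvd e * r * x + (y + z)"
    using b(1) by (rule block_cases)
  define s where "s = y + z"
  have s: "s \<ge> 0" "m * r dvd e * r * x + s" using v by (auto simp: s_def)
  have w: "wsum cl b = e * r * x + s" "wsum cl' b = r * x + e' * s" by (simp_all add: v wsum_vec s_def)
  have ge: "e * r * x + s \<ge> m * r" "r * x + e' * s \<ge> m * r"
    using weights[OF b(1)] b(2) w by (auto intro: zdvd_imp_le)
  have eq: "x = x' \<and> s = s'" if "0 \<le> x'" "x' \<le> x" "0 \<le> s'" "s' \<le> s"
    "m * r dvd e * r * x' + s'" "x' > 0 \<or> s' > 0" for x' s'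
    using block_atom_eq[of x y z x' s'] atom v that by (simp add: s_def)
  show ?thesis
  proof (cases "c2 * (r * x) \<le> c1 * s")
    case upper: True
    \<comment> \<open>The points \<open>(i, r * (m - i * e))\<close> with \<open>i \<le> c1\<close>
      form the piece on which the \<open>cl\<close> weight is \<open>m * r\<close>; it ends at the
      bend, as \<open>m - c1 * e = c2\<close>.\<close>
    define i where "i = min x c1"
    have i: "0 \<le> i" "i \<le> x" "i \<le> c1" using v pos by (auto simp: i_def)
    have "i * e \<le> c1 * e" using i e_pos by (intro mult_right_mono) auto
    then have rem: "m - i * e > 0" using m_eq(1) pos by linarith
    have le: "r * (m - i * e) \<le> s"
    proof (cases "c1 \<le> x")
      case True
      then have "c1 * (r * c2) \<le> c2 * (r * x)" using pos by (simp add: mult.commute mult.left_commute)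
      then have "c1 * (r * c2) \<le> c1 * s" using upper by linarith
      then show ?thesis using True pos m_eq(1) by (simp add: i_def)
    next
      case False
      then have "i = x" by (simp add: i_def)
      then show ?thesis using ge(1) by (simp add: algebra_simps)
    qed
    have sum: "e * r * i + r * (m - i * e) = m * r" by (simp add: algebra_simps)
    have "x = i \<and> s = r * (m - i * e)"
      using i le rem pos by (intro eq) (auto simp: sum)
    then show ?thesis using w sum by auto
  next
    case lower: False
    have "r dvd m * r" "r dvd e * r * x" by auto
    then have "r dvd s" using s(2) by (meson dvd_add_right_iff dvd_trans)
    then obtain t where t: "s = r * t" by blast
    have t0: "t \<ge> 0" using s(1) pos by (simp add: t zero_le_mult_iff)
    \<comment> \<open>The points \<open>(m - j * e', r * j)\<close> with \<open>j \<le> c2\<close>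
      form the other piece, on which the \<open>cl'\<close> weight is \<open>m * r\<close>.\<close>
    define j where "j = min t c2"
    have j: "0 \<le> j" "j \<le> t" "j \<le> c2" using t0 pos by (auto simp: j_def)
    have "j * e' \<le> c2 * e'" using j e_pos by (intro mult_right_mono) auto
    then have rem: "m - j * e' > 0" using m_eq(2) pos by linarith
    have le: "m - j * e' \<le> x"
    proof (cases "c2 \<le> t")
      case True
      then have "r * (c1 * c2) \<le> r * (c1 * t)" using pos by simp
      also have "\<dots> < r * (c2 * x)" using lower by (simp add: t algebra_simps)
      finally have "c1 * c2 < c2 * x" using pos by simp
      then have "c1 < x" using pos by (simp add: mult.commute)
      then show ?thesis using True m_eq(2) by (simp add: j_def)
    next
      case False
      then have "r * (m - j * e') \<le> r * x" using ge(2) by (simp add: t j_def algebra_simps)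
      then show ?thesis using pos by simp
    qed
    have sum: "r * (m - j * e') + e' * (r * j) = m * r" by (simp add: algebra_simps)
    have "e * r * (m - j * e') + r * j = m * r * e - r * j * (e * e' - 1)"
      by (simp add: algebra_simps)
    also have "\<dots> = m * r * (e - j * q)" by (simp add: e_mult algebra_simps)
    finally have "m * r dvd e * r * (m - j * e') + r * j" by simp
    then have "x = m - j * e' \<and> s = r * j"
      using j le rem pos by (intro eq) (auto simp: t)
    then show ?thesis using w sum by auto
  qed
qed

text \<open>Each atom has one normalized weight equal to 1, hence its normalized \<open>cl\<close>
  weight is 1 modulo \<open>q\<close>; additivity then recovers the length modulo
  \<open>q\<close>.\<close>

lemma weight_sum_atoms:
  assumes "\<forall>a\<in>set us. block_atom a"
  shows "q dvd wsum cl (sum_list us) div (m * r) - int (length us)"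
  using assms
proof (induction us)
  case (Cons a us)
  have a: "block a" "block_atom a" using Cons.prems by (auto simp: block_atom_def)
  have "q dvd wsum cl a div (m * r) - 1"
  proof -
    have "m * r div (m * r) = 1" using n_pos by (intro div_self) linarith
    then show ?thesis using weight_block_atom[OF a(2)] weights(3)[OF a(1)]
      by (metis cancel_comm_monoid_add_class.diff_cancel dvd_0_right)
  qed
  moreover have "wsum cl (sum_list (a # us)) div (m * r) =
      wsum cl a div (m * r) + wsum cl (sum_list us) div (m * r)"
    using weights(1)[OF a(1)] by (simp add: wsum_add div_plus_div_distrib_dvd_left)
  then have "wsum cl (sum_list (a # us)) div (m * r) - int (length (a # us)) =
      (wsum cl a div (m * r) - 1) + (wsum cl (sum_list us) div (m * r) - int (length us))"
    by simp
  ultimately show ?case using Cons by (metis dvd_add list.set_intros(2))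
qed simp

lemma length_congruent_divisor:
  assumes "d dvd q" shows "length_congruent d"
  unfolding length_congruent_def
proof (intro allI impI)
  fix us vs assume uv: "\<forall>a\<in>set us \<union> set vs. block_atom a" "sum_list us = sum_list vs"
  let ?l = "wsum cl (sum_list us) div (m * r)"
  have "q dvd ?l - int (length us)" using uv by (intro weight_sum_atoms) auto
  moreover have "q dvd ?l - int (length vs)" unfolding uv(2) using uv by (intro weight_sum_atoms) auto
  ultimately have "q dvd (?l - int (length vs)) - (?l - int (length us))" by (rule dvd_diff[rotated])
  then show "d dvd int (length us) - int (length vs)" using assms by (simp add: dvd_trans)
qed

lemma vec_add: "vec x y z + vec x' y' z' = vec (x + x') (y + y') (z + z')"
  by (simp add: vec_def single_add algebra_simps)

lemma sum_list_replicate_vec: "sum_list (replicate k (vec x y z)) = vec (int k * x) (int k * y) (int k * z)"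
proof (induction k)
  case (Suc k)
  then show ?case by (simp add: vec_add algebra_simps)
qed (simp add: vec_def)

text \<open>Taken \<open>m\<close> times, the bend \<open>(c1, r * c2)\<close> equals
  \<open>c1\<close> copies of \<open>(m, 0)\<close> plus \<open>c2\<close> copies of
  \<open>(0, m * r)\<close>, and \<open>m > c1 + c2\<close>.\<close>

lemma different_lengths:
  "\<exists>us vs. (\<forall>a\<in>set us \<union> set vs. block_atom a) \<and> sum_list us = sum_list vs \<and> length us \<noteq> length vs"
proof -
  have e: "e * r * c1 + r * c2 = m * r" by (simp add: m_eq(1) algebra_simps)
  have A: "block_atom (vec m 0 0)" "block_atom (vec 0 (m * r) 0)" "block_atom (vec c1 (r * c2) 0)"
    using pos m_pos e
    by (intro block_atom_weight; simp add: block_vec_iff vec_eq_0_iff wsum_vec)+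
  define us where "us = replicate (nat m) (vec c1 (r * c2) 0)"
  define vs where "vs = replicate (nat c1) (vec m 0 0) @ replicate (nat c2) (vec 0 (m * r) 0)"
  have "\<forall>a\<in>set us \<union> set vs. block_atom a" using A by (auto simp: us_def vs_def)
  moreover have "sum_list us = sum_list vs"
    using m_pos pos by (simp add: us_def vs_def sum_list_replicate_vec vec_add mult_ac)
  moreover have "length us \<noteq> length vs"
  proof -
    have "q * c1 * c2 > 0" using pos by simp
    then have "m > c1 + c2" by (simp add: m_def)
    then show ?thesis using pos by (simp add: us_def vs_def nat_add_distrib[symmetric])
  qed
  ultimately show ?thesis by blast
qed

text \<open>Here the third prime is essential: \<open>r\<close> divides \<open>y + z\<close> in
  every block, so for \<open>r > 1\<close> a lone prime of class 1 could not be a gcd of blocks.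
  Splitting \<open>m * r\<close> as \<open>1 + (m * r - 1)\<close> over \<open>p2\<close> and
  \<open>p3\<close> avoids this.\<close>

lemma primes_are_gcds:
  assumes "p \<in> {p1, p2, p3}"
  shows "\<exists>u v. block u \<and> block v \<and>
    (\<forall>j. min (Poly_Mapping.lookup u j) (Poly_Mapping.lookup v j) = (if j = p then 1 else 0))"
proof -
  have m1: "m * r \<ge> 1" "m \<ge> 1" using n_pos m_pos by auto
  have "m - e = (c1 - 1) * e + c2" by (simp add: m_eq(1) algebra_simps)
  moreover have "(c1 - 1) * e \<ge> 0" using pos e_pos by (intro mult_nonneg_nonneg) auto
  ultimately have me: "r * (m - e) \<ge> 0" using pos by simp
  have lookup: "Poly_Mapping.lookup (vec x y z) j =
      (if j = p1 then x else if j = p2 then y else if j = p3 then z else 0)" for x y z j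
    using lookup_vec(1-3)[of x y z] lookup_vec(4) by simp
  consider "p = p1" | "p = p2" | "p = p3" using assms by blast
  then show ?thesis
  proof cases
    case 1
    have "e * r * 1 + (r * (m - e) + 0) = m * r" "e * r * m + (0 + 0) = (m * r) * e"
      by (simp_all add: algebra_simps)
    then have "block (vec 1 (r * (m - e)) 0)" "block (vec m 0 0)"
      unfolding block_vec_iff using me m1 by simp_all
    then show ?thesis
      by (rule_tac exI[of _ "vec 1 (r * (m - e)) 0"], rule_tac exI[of _ "vec m 0 0"])
        (use 1 distinct me m1 in \<open>auto simp: lookup\<close>)
  next
    case 2
    have "block (vec 0 1 (m * r - 1))" "block (vec 0 (m * r) 0)"
      using m1 by (auto simp: block_vec_iff)
    then show ?thesis
      by (rule_tac exI[of _ "vec 0 1 (m * r - 1)"], rule_tac exI[of _ "vec 0 (m * r) 0"])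
        (use 2 distinct m1 in \<open>auto simp: lookup\<close>)
  next
    case 3
    have "block (vec 0 (m * r - 1) 1)" "block (vec 0 0 (m * r))"
      using m1 by (auto simp: block_vec_iff)
    then show ?thesis
      by (rule_tac exI[of _ "vec 0 (m * r - 1) 1"], rule_tac exI[of _ "vec 0 0 (m * r)"])
        (use 3 distinct m1 in \<open>auto simp: lookup\<close>)
  qed
qed

text \<open>A block is determined by three integers, so there are countably many and they fit into
  any infinite type.\<close>

lemma exists_block_injection: "\<exists>g :: ('p \<Rightarrow>\<^sub>0 int) \<Rightarrow> 'a :: infinite. inj_on g (Collect block)"
proof -
  obtain f :: "nat \<Rightarrow> 'a" where f: "inj f"
    using infinite_countable_subset[OF infinite_UNIV] by blast
  define k where "k = (\<lambda>b :: 'p \<Rightarrow>\<^sub>0 int. (Poly_Mapping.lookup b p1, Poly_Mapping.lookup b p2, Poly_Mapping.lookup b p3))"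
  have "inj_on k (Collect block)"
  proof (rule inj_onI)
    fix b b' assume "b \<in> Collect block" "b' \<in> Collect block" "k b = k b'"
    then show "b = b'" using vec_surj[of b] vec_surj[of b'] by (simp add: k_def block_def)
  qed
  moreover have "inj (f \<circ> (to_nat :: int \<times> int \<times> int \<Rightarrow> nat))"
    using f by (intro inj_compose) auto
  ultimately have "inj_on ((f \<circ> to_nat) \<circ> k) (Collect block)"
    by (meson comp_inj_on inj_on_subset subset_UNIV)
  then show ?thesis by blast
qed

end

lemma divisor_mem_J_imp_class_group:
  fixes d n :: nat
  assumes n: "n > 0" and d: "d \<in> (\<Union>m\<in>{m. m dvd n}. J m)"
  shows "\<exists>(H :: ('a :: infinite) monoid) (P :: ('p :: infinite) set) \<phi>. comm_monoid_cancel H \<and>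
    \<not> half_factorial H \<and> congruence_half_factorial d H \<and> divisor_theory H P \<phi> \<and>
    cyclic_group (class_group H P \<phi>) \<and> order (class_group H P \<phi>) = n"
proof -
  obtain M c1 c2 q where M: "M dvd n" and c: "c1 \<in> {1..M}" "c2 \<in> {1..M}" and q: "q > 0" "d dvd q"
    and eq: "(real M - real c1 - real c2) / (real c1 * real c2) = real q"
    using d by (auto simp: J_def)
  have "real M = real (c1 + c2 + q * c1 * c2)" using eq c by (simp add: field_simps)
  then have Mc: "M = c1 + c2 + q * c1 * c2" by (simp only: of_nat_eq_iff)
  obtain r where r: "n = M * r" using M by blast
  have "r > 0" using n r by simp
  \<comment> \<open>Any three distinct elements of the infinite type serve as the primes.\<close>
  obtain p1 :: 'p where True by simp
  obtain p2 :: 'p where p2: "p2 \<notin> {p1}" using arb_element[of "{p1}"] by auto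
  obtain p3 :: 'p where p3: "p3 \<notin> {p1, p2}" using arb_element[of "{p1, p2}"] by auto
  interpret T: three_primes p1 p2 p3 "int c1" "int c2" "int q" "int r"
    using p2 p3 c q \<open>r > 0\<close> by unfold_locales auto
  have n_eq: "T.m * int r = int n" unfolding T.m_def r Mc by simp
  obtain g :: "('p \<Rightarrow>\<^sub>0 int) \<Rightarrow> 'a" where g: "inj_on g (Collect T.block)"
    using T.exists_block_injection by blast
  obtain H :: "'a monoid" and \<phi> where "block_presentation {p1, p2, p3} T.cl (T.m * int r) H \<phi>"
    using T.exists_presentation[OF g] by blast
  then interpret B: block_presentation "{p1, p2, p3}" T.cl "T.m * int r" H \<phi> .
  have "comm_monoid_cancel H" by (rule B.comm_monoid_cancel_axioms)
  moreover have "\<not> half_factorial H" unfolding B.half_factorial_iff using T.different_lengths by blast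
  moreover have "congruence_half_factorial d H"
    unfolding B.congruence_half_factorial_iff using q by (intro T.length_congruent_divisor) simp
  moreover have "divisor_theory H {p1, p2, p3} \<phi>" by (rule B.divisor_theoryI) (rule T.primes_are_gcds)
  moreover have "T.cl p2 = 1" using p2 by (simp add: T.cl_def)
  then have "cyclic_group (class_group H {p1, p2, p3} \<phi>)" "order (class_group H {p1, p2, p3} \<phi>) = n"
    using B.class_group_cyclic_order[of p2] n_eq by simp_all
  ultimately show ?thesis by blast
qed

section \<open>The equivalence\<close>

theorem theorem8p3:
  fixes d n :: nat
  assumes "d > 0" and "n > 0" and "real d > sqrt (real n)"
  shows "(\<exists>H :: ('a :: infinite) monoid.
            krull_monoid TYPE('p :: infinite) H \<and>
            \<not> half_factorial H \<and>
            congruence_half_factorial d H \<and>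
            (\<exists>(P :: 'p set) \<phi>. divisor_theory H P \<phi> \<and>
               cyclic_group (class_group H P \<phi>) \<and> order (class_group H P \<phi>) = n))
         \<longleftrightarrow> d \<in> (\<Union>m\<in>{m. m dvd n}. J m)" (is "?L \<longleftrightarrow> ?R")
proof
  assume ?L
  then obtain H :: "'a monoid" and P :: "'p set" and \<phi> where H: "krull_monoid TYPE('p) H"
    "\<not> half_factorial H" "congruence_half_factorial d H" "divisor_theory H P \<phi>"
    "cyclic_group (class_group H P \<phi>)" "order (class_group H P \<phi>) = n"
    by blast
  have "real n < real d * real d"
    using assms by (metis of_nat_0_le_iff power2_eq_square real_less_lsqrt real_sqrt_less_iff
        real_sqrt_unique linorder_not_less real_sqrt_ge_zero real_sqrt_abs2 abs_of_nonneg)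
  then have "n < d * d" by (metis of_nat_less_iff of_nat_mult)
  then show ?R
    using H assms by (intro class_group_order_imp_J[of H P \<phi>])
      (auto simp: krull_monoid_def divisor_theory_def)
next
  assume ?R
  from divisor_mem_J_imp_class_group[OF assms(2) this, where 'a = 'a and 'p = 'p]
  obtain H :: "'a monoid" and P :: "'p set" and \<phi> where H: "comm_monoid_cancel H"
    "\<not> half_factorial H" "congruence_half_factorial d H" "divisor_theory H P \<phi>"
    "cyclic_group (class_group H P \<phi>)" "order (class_group H P \<phi>) = n"
    by blast
  moreover have "krull_monoid TYPE('p) H"
    using H(1,4) unfolding krull_monoid_def divisor_theory_def by blast
  ultimately show ?L by blast
qed

end
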